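(* (Meromorphic Montel--Carathéodory Theorem) Let $m,n\ge 1$ be integers and let $D$ be a domain in $\mathbb{C}^m$. Let $\mathcal{F}$ be a family of meromorphic mappings from $D$ into $\mathbb{P}^n$. Suppose that $H_1,\dots,H_{2n+1}$ are $2n+1$ hyperplanes in general position in $\mathbb{P}^n$. If for each $k\in\{1,\dots,2n+1\}$ and each $f\in\mathcal{F}$, $f(D)\not\subset H_k$ and $\nu(f,H_k)\equiv0$, then $\mathcal{F}$ is meromorphically normal.
   Context: Homogeneous coordinates $[w_0:\cdots:w_n]$ on complex projective space $\mathbb{P}^n$ are fixed. Meromorphic mappings. For a meromorphic mapping $f:D\to\mathbb{P}^n$, $I(f)$ denotes its indeterminacy locus, an analytic subset of $D$ of codimension at least $2$ (empty if $m=1$); $f$ is holomorphic on $D\setminus I(f)$. Each $a\in D$ has a neighborhood $U$ with a holomorphic map $\widetilde f=(f_0,\dots,f_n):U\to\mathbb{C}^{n+1}$ such that $f(z)=[f_0(z):\cdots:f_n(z)]$ for $z\in U\setminus I(f)$ and $I(f)\cap U=\{z\in U: f_0(z)=\cdots=f_n(z)=0\}$. Any such $\widetilde f$ is called an admissible (reduced) representation of $f$ on $U$. The notation $f(D)\not\subset H$. For a hyperplane $H\subset\mathbb{P}^n$, $f(D)\not\subset H$ means that $\Gamma_f:=\overline{\{(z,f(z)):z\in D\setminus I(f)\}}$ is not a subset of $D\times H$. The divisor $\nu(f,H)$. For a holomorphic function $h\not\equiv 0$ near $a$, $\nu_h(a)$ is the order of vanishing of $h$ at $a$ (the least degree of a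 nonzero homogeneous term in the power series of $h$ at $a$). If $H=\{\sum_{l=0}^n a_lw_l=0\}$ and $f(D)\not\subset H$, the divisor $\nu(f,H):D\to\mathbb{Z}_{\ge0}$ is defined by $\nu(f,H)|_U:=\nu_{f^*H}$, where $f^*H:=a_0f_0+\cdots+a_nf_n$ for any admissible representation $(f_0,\dots,f_n)$ of $f$ on $U$; this is independent of choices. General position. Hyperplanes $H_1,\dots,H_q$ in $\mathbb{P}^n$, $q\ge n+1$, with $H_k=\{\sum_l a^{(k)}_lw_l=0\}$, are in general position if any $n+1$ of the coefficient vectors $(a^{(k)}_0,\dots,a^{(k)}_n)$, taken with distinct indices $k$, have nonzero determinant. Meromorphic normality. A sequence $\{f_j\}$ of meromorphic mappings $D\to\mathbb{P}^n$ converges meromorphically on $D$ to a meromorphic mapping $f$ if each $a\in D$ has an open neighborhood $U$ and admissible representations $(f_{j,0},\dots,f_{j,n})$ of $f_j$ on $U$, $j=1,2,\dots$, such that for each $l$ the sequence $\{f_{j,l}\}_j$ converges uniformly on compact subsets of $U$ to a holomorphic function $f_l$ on $U$, with $f_{l_0}\not\equiv0$ on $U$ for some $l_0$, and $f(z)=[f_0(z):\cdots:f_n(z)]$ for all $z\in U\setminus\bigcap_{l=0}^n f_l^{-1}\{0\}$. A family $\mathcal{F}$ of meromorphic mappings $D\to\mathbb{P}^n$ is meromorphically normal if every sequence in $\mathcal{F}$ has a subsequence that converges meromorphically on $D$. *)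

theory Defs
  imports "HOL-Analysis.Analysis" "HOL-Library.Extended_Nat"
begin

section \<open>Complex projective space\<close>

text \<open>
  The finite type \<open>'n\<close> indexes the homogeneous coordinates, so \<open>'n proj\<close> is the projective
  space of dimension \<open>CARD('n) - 1\<close>.
\<close>

definition proj_rel :: "complex ^ 'n \<Rightarrow> complex ^ 'n \<Rightarrow> bool" where
  "proj_rel v w \<longleftrightarrow> v \<noteq> 0 \<and> (\<exists>c. c \<noteq> 0 \<and> w = c *s v)"

lemma part_equivp_proj_rel: "part_equivp (proj_rel :: complex ^ 'n \<Rightarrow> _)" (is "part_equivp ?R")
proof (rule part_equivpI)
  show "\<exists>x. ?R x x"
    by (rule exI[of _ 1]) (auto simp: proj_rel_def intro!: exI[of _ 1])
  show "symp ?R"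
  proof (rule sympI)
    fix x y :: "complex ^ 'n"
    assume "proj_rel x y"
    then obtain c where c: "x \<noteq> 0" "c \<noteq> 0" "y = c *s x"
      by (auto simp: proj_rel_def)
    have "inverse c *s y = x"
      using c(2) unfolding c(3) by (simp add: vector_smult_assoc)
    moreover have "y \<noteq> 0"
      using c(1,2) unfolding c(3) by (simp add: vector_mul_eq_0)
    ultimately show "proj_rel y x"
      unfolding proj_rel_def using c(2) by (metis inverse_nonzero_iff_nonzero)
  qed
  show "transp ?R"
  proof (rule transpI)
    fix x y z :: "complex ^ 'n"
    assume "proj_rel x y" "proj_rel y z"
    then obtain c d where "x \<noteq> 0" "c \<noteq> 0" "y = c *s x" "d \<noteq> 0" "z = d *s y"
      by (auto simp: proj_rel_def)
    then show "proj_rel x z"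
      unfolding proj_rel_def by (metis mult_eq_0_iff vector_smult_assoc)
  qed
qed

quotient_type 'n proj = "complex ^ 'n" / partial: proj_rel
  by (rule part_equivp_proj_rel)

text \<open>The point with homogeneous coordinates \<open>w\<close>; only meaningful for \<open>w \<noteq> 0\<close>.\<close>

definition proj_class :: "complex ^ 'n \<Rightarrow> 'n proj" where
  "proj_class w = abs_proj w"

text \<open>The quotient topology.\<close>

instantiation proj :: (finite) topological_space
begin

definition open_proj :: "'a proj set \<Rightarrow> bool" where
  "open_proj S \<longleftrightarrow> open {w. w \<noteq> 0 \<and> proj_class w \<in> S}"

instance
proof
  have "{w :: complex ^ 'a. w \<noteq> 0} = - {0}"
    by auto
  then show "open (UNIV :: 'a proj set)"
    by (simp add: open_proj_def open_Compl)
next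
  fix S T :: "'a proj set"
  assume "open S" "open T"
  moreover have "{w. w \<noteq> 0 \<and> proj_class w \<in> S \<inter> T} =
      {w. w \<noteq> 0 \<and> proj_class w \<in> S} \<inter> {w. w \<noteq> 0 \<and> proj_class w \<in> T}"
    by auto
  ultimately show "open (S \<inter> T)"
    by (simp add: open_proj_def open_Int)
next
  fix K :: "'a proj set set"
  assume "\<forall>S\<in>K. open S"
  moreover have "{w. w \<noteq> 0 \<and> proj_class w \<in> \<Union>K} =
      (\<Union>S\<in>K. {w. w \<noteq> 0 \<and> proj_class w \<in> S})"
    by auto
  ultimately show "open (\<Union>K)"
    by (auto simp: open_proj_def intro!: open_UN)
qed

end

definition hyperplane :: "complex ^ 'n \<Rightarrow> 'n proj set" where
  "hyperplane a = {proj_class w | w. w \<noteq> 0 \<and> (\<Sum>l\<in>UNIV. a $ l * w $ l) = 0}"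

text \<open>
  The determinants vanish or not independently of the choice of the coefficient vectors, which
  are unique up to nonzero factors.
\<close>

definition general_position :: "nat \<Rightarrow> (nat \<Rightarrow> 'n::finite proj set) \<Rightarrow> bool" where
  "general_position q H \<longleftrightarrow> CARD('n) \<le> q \<and>
     (\<exists>a :: nat \<Rightarrow> complex ^ 'n.
        (\<forall>k\<in>{1..q}. a k \<noteq> 0 \<and> H k = hyperplane (a k)) \<and>
        (\<forall>\<sigma> :: 'n \<Rightarrow> nat. inj \<sigma> \<and> range \<sigma> \<subseteq> {1..q} \<longrightarrow> det (\<chi> i. a (\<sigma> i)) \<noteq> 0))"


section \<open>Holomorphic functions and analytic sets in several variables\<close>

text \<open>Both notions are intended for open \<open>U\<close>.\<close>

definition holo_on :: "(complex ^ 'm \<Rightarrow> complex) \<Rightarrow> (complex ^ 'm) set \<Rightarrow> bool" where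
  "holo_on h U \<longleftrightarrow>
     (\<forall>z\<in>U. \<exists>h'. (h has_derivative h') (at z) \<and> (\<forall>c v. h' (c *s v) = c * h' v))"

definition holo_map_on :: "(complex ^ 'm \<Rightarrow> complex ^ 'k) \<Rightarrow> (complex ^ 'm) set \<Rightarrow> bool" where
  "holo_map_on F U \<longleftrightarrow> (\<forall>i. holo_on (\<lambda>z. F z $ i) U)"

text \<open>
  Along the complex line through \<open>a\<close> in direction \<open>w\<close> the expansion of \<open>h\<close> into homogeneous
  polynomials \<open>P\<^sub>k\<close> around \<open>a\<close> reads \<open>h (a + t w) = (\<Sum>k. P\<^sub>k w * t ^ k)\<close>, whence the formula
  for \<open>P\<^sub>k\<close>.
\<close>

definition homogeneous_term :: "(complex ^ 'm \<Rightarrow> complex) \<Rightarrow> complex ^ 'm \<Rightarrow> nat \<Rightarrow> complex ^ 'm \<Rightarrow> complex"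
  where "homogeneous_term h a k w = (deriv ^^ k) (\<lambda>t. h (a + t *s w)) 0 / fact k"

text \<open>The value is \<open>\<infinity>\<close> exactly when \<open>h\<close> vanishes identically near \<open>a\<close>.\<close>

definition vanishing_order :: "(complex ^ 'm \<Rightarrow> complex) \<Rightarrow> complex ^ 'm \<Rightarrow> enat" where
  "vanishing_order h a = Inf {enat k | k. \<exists>w. homogeneous_term h a k w \<noteq> 0}"

definition analytic_subset :: "(complex ^ 'm) set \<Rightarrow> (complex ^ 'm) set \<Rightarrow> bool" where
  "analytic_subset D A \<longleftrightarrow> A \<subseteq> D \<and>
     (\<forall>a\<in>D. \<exists>U G. open U \<and> a \<in> U \<and> U \<subseteq> D \<and> finite G \<and> (\<forall>g\<in>G. holo_on g U) \<and>
        A \<inter> U = {z\<in>U. \<forall>g\<in>G. g z = 0})"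

text \<open>Near \<open>a\<close>, the set \<open>A\<close> is a complex submanifold of dimension \<open>p\<close>.\<close>

definition regular_point :: "(complex ^ 'm) set \<Rightarrow> complex ^ 'm \<Rightarrow> nat \<Rightarrow> bool" where
  "regular_point A a p \<longleftrightarrow> a \<in> A \<and>
     (\<exists>U V \<phi> \<psi> L. open U \<and> a \<in> U \<and> open V \<and>
        holo_map_on \<phi> U \<and> holo_map_on \<psi> V \<and> \<phi> ` U = V \<and> \<psi> ` V = U \<and>
        (\<forall>z\<in>U. \<psi> (\<phi> z) = z) \<and> (\<forall>w\<in>V. \<phi> (\<psi> w) = w) \<and>
        vec.subspace L \<and> vec.dim L = p \<and> \<phi> ` (A \<inter> U) = V \<inter> (L :: (complex ^ 'm) set))"

text \<open>
  The dimension of an analytic set is the largest dimension attained at its regular points, which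
  are dense in it.
\<close>

definition codim_ge :: "(complex ^ 'm) set \<Rightarrow> nat \<Rightarrow> bool" where
  "codim_ge A c \<longleftrightarrow> (\<forall>a p. regular_point A a p \<longrightarrow> p + c \<le> CARD('m))"


section \<open>Meromorphic mappings\<close>

text \<open>
  A meromorphic mapping on \<open>D\<close> is encoded as a function that takes the value \<^const>\<open>None\<close> at the
  points of indeterminacy. Values outside \<open>D\<close> are irrelevant.
\<close>

type_synonym ('m, 'n) pmap = "complex ^ 'm \<Rightarrow> 'n proj option"

definition indeterminacy :: "(complex ^ 'm) set \<Rightarrow> ('m::finite, 'n::finite) pmap \<Rightarrow> (complex ^ 'm) set" where
  "indeterminacy D f = {z\<in>D. f z = None}"

definition admissible_rep ::
  "(complex ^ 'm) set \<Rightarrow> ('m::finite, 'n::finite) pmap \<Rightarrow> (complex ^ 'm) set \<Rightarrow>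
   (complex ^ 'm \<Rightarrow> complex ^ 'n) \<Rightarrow> bool" where
  "admissible_rep D f U F \<longleftrightarrow> open U \<and> U \<subseteq> D \<and> holo_map_on F U \<and>
     (\<forall>z \<in> U - indeterminacy D f. f z = Some (proj_class (F z))) \<and>
     indeterminacy D f \<inter> U = {z\<in>U. \<forall>l. F z $ l = 0}"

text \<open>
  Holomorphy outside the indeterminacy locus, in the sense of the standard charts, is contained in
  the last condition, since there the representations have no common zeros.
\<close>

definition meromorphic_map :: "(complex ^ 'm) set \<Rightarrow> ('m::finite, 'n::finite) pmap \<Rightarrow> bool" where
  "meromorphic_map D f \<longleftrightarrow>
     analytic_subset D (indeterminacy D f) \<and> codim_ge (indeterminacy D f) 2 \<and>
     (\<forall>a\<in>D. \<exists>U F. a \<in> U \<and> admissible_rep D f U F)"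

text \<open>The closure is taken relative to \<open>D \<times> UNIV\<close>.\<close>

definition closed_graph ::
  "(complex ^ 'm) set \<Rightarrow> ('m::finite, 'n::finite) pmap \<Rightarrow> ((complex ^ 'm) \<times> 'n proj) set" where
  "closed_graph D f =
     closure {(z, the (f z)) | z. z \<in> D - indeterminacy D f} \<inter> (D \<times> UNIV)"

definition image_contained ::
  "(complex ^ 'm) set \<Rightarrow> ('m::finite, 'n::finite) pmap \<Rightarrow> 'n proj set \<Rightarrow> bool" where
  "image_contained D f H \<longleftrightarrow> closed_graph D f \<subseteq> D \<times> H"

text \<open>
  For a meromorphic \<open>f\<close> and a hyperplane \<open>H\<close> that does not contain the image of \<open>f\<close>, the value is
  finite and does not depend on the chosen representation and coefficient vector.
\<close>

definition divisor ::
  "(complex ^ 'm) set \<Rightarrow> ('m::finite, 'n::finite) pmap \<Rightarrow> 'n proj set \<Rightarrow> complex ^ 'm \<Rightarrow> enat" where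
  "divisor D f H z = (SOME \<nu>. \<exists>U F a. z \<in> U \<and> admissible_rep D f U F \<and> a \<noteq> 0 \<and>
     H = hyperplane a \<and> \<nu> = vanishing_order (\<lambda>y. \<Sum>l\<in>UNIV. a $ l * F y $ l) z)"


section \<open>Meromorphic convergence and normality\<close>

text \<open>
  The neighborhoods are connected: on a disconnected \<open>U\<close> the condition that the limit is not
  identically zero would say nothing about the component containing \<open>a\<close>.
\<close>

definition converges_meromorphically ::
  "(complex ^ 'm) set \<Rightarrow> (nat \<Rightarrow> ('m::finite, 'n::finite) pmap) \<Rightarrow> ('m, 'n) pmap \<Rightarrow> bool" where
  "converges_meromorphically D s f \<longleftrightarrow> meromorphic_map D f \<and>
     (\<forall>a\<in>D. \<exists>U F G. open U \<and> connected U \<and> a \<in> U \<and> U \<subseteq> D \<and>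
        (\<forall>j. admissible_rep D (s j) U (F j)) \<and>
        holo_map_on G U \<and>
        (\<forall>l K. compact K \<and> K \<subseteq> U \<longrightarrow>
           uniform_limit K (\<lambda>j z. F j z $ l) (\<lambda>z. G z $ l) sequentially) \<and>
        (\<exists>l\<^sub>0. \<exists>z\<in>U. G z $ l\<^sub>0 \<noteq> 0) \<and>
        (\<forall>z \<in> U - {z. \<forall>l. G z $ l = 0}. f z = Some (proj_class (G z))))"

definition meromorphically_normal ::
  "(complex ^ 'm) set \<Rightarrow> ('m::finite, 'n::finite) pmap set \<Rightarrow> bool" where
  "meromorphically_normal D \<F> \<longleftrightarrow>
     (\<forall>s :: nat \<Rightarrow> ('m, 'n) pmap. range s \<subseteq> \<F> \<longrightarrow>
        (\<exists>r f. strict_mono r \<and> converges_meromorphically D (s \<circ> r) f))"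

end

(*
  Since the divisors vanish, every f in the family is holomorphic and avoids all the hyperplanes
  H_k. Near a point p normalize the homogeneous coordinates so that the linear form of H_k equals
  1, where k is chosen such that this form is the largest one at p. By Montel's theorem it suffices
  to bound the other forms uniformly near p, and this may be done on complex lines through p.

  There the forms are exp (g l) with harmonic u l = Re (g l), and by general position any n + 1 of
  the u l have the same maximum u up to a bounded error. Following the potential-theoretic proof of
  Picard's theorem by Eremenko and Sodin, normalize and pass to a limit without error term: at each
  point at least (2n + 1) - n = n + 1 of the limit functions attain the maximum, so on some open
  set, hence everywhere, n + 1 of them coincide, and the maximum itself is harmonic. By the maximum
  principle it is then the constant 0 after subtracting a function that is maximal at the centre.
  Hence a bound A * T for u - u k on a disc with k maximal at its centre improves to T on the
  half disc when T is large. A chain of Harnack inequalities turns the bound T at scale s into the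
  bound A * T at scale 4 s, so the bound T propagates from tiny scales to a universal one.
*)
theory Submission
  imports Defs "HOL-Complex_Analysis.Great_Picard"
begin

section \<open>Nonvanishing functions on a disc\<close>

text \<open>One subsequence has to serve all indices of \<open>Q\<close> at once. The induction
  applies \<open>Montel\<close> to the next index along the subsequence found so far; the earlier
  limits survive the refinement.\<close>

lemma Montel_finite:
  fixes F :: "'i \<Rightarrow> nat \<Rightarrow> complex \<Rightarrow> complex"
  assumes "finite Q" "open S"
    and "\<And>l j. l \<in> Q \<Longrightarrow> F l j holomorphic_on S"
    and "\<And>l j z. l \<in> Q \<Longrightarrow> z \<in> S \<Longrightarrow> norm (F l j z) \<le> B"
  shows "\<exists>r g. strict_mono (r :: nat \<Rightarrow> nat) \<and> (\<forall>l\<in>Q. g l holomorphic_on S \<and>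
     (\<forall>K. compact K \<and> K \<subseteq> S \<longrightarrow> uniform_limit K (\<lambda>j. F l (r j)) (g l) sequentially))"
  using assms
proof (induction Q rule: finite_induct)
  case empty
  show ?case
    by (intro exI[of _ id]) (auto simp: strict_mono_def)
next
  case (insert x Q)
  have "\<exists>r g. strict_mono (r :: nat \<Rightarrow> nat) \<and> (\<forall>l\<in>Q. g l holomorphic_on S \<and>
     (\<forall>K. compact K \<and> K \<subseteq> S \<longrightarrow> uniform_limit K (\<lambda>j. F l (r j)) (g l) sequentially))"
    using insert.prems by (intro insert.IH) simp_all
  then obtain r g where r: "strict_mono (r :: nat \<Rightarrow> nat)"
    and g: "\<forall>l\<in>Q. g l holomorphic_on S \<and>
      (\<forall>K. compact K \<and> K \<subseteq> S \<longrightarrow> uniform_limit K (\<lambda>j. F l (r j)) (g l) sequentially)"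
    by blast
  obtain h r' where h: "h holomorphic_on S" "strict_mono (r' :: nat \<Rightarrow> nat)"
    and "\<And>K. \<lbrakk>compact K; K \<subseteq> S\<rbrakk> \<Longrightarrow> uniform_limit K ((\<lambda>j. F x (r j)) \<circ> r') h sequentially"
  proof (rule Montel[OF \<open>open S\<close>, of "range (\<lambda>j. F x (r j))" "\<lambda>j. F x (r j)"])
    show "\<exists>B. \<forall>h\<in>range (\<lambda>j. F x (r j)). \<forall>z\<in>K. norm (h z) \<le> B" if "K \<subseteq> S" for K
      using insert.prems(3) that by (intro exI[of _ B]) auto
  qed (use insert.prems in auto)
  then have ul: "uniform_limit K (\<lambda>j. F x (r (r' j))) h sequentially" if "compact K" "K \<subseteq> S" for K
    using that by (simp add: o_def)
  show ?case
  proof (intro exI[of _ "r \<circ> r'"] exI[of _ "g(x := h)"] conjI ballI allI impI)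
    show "strict_mono (r \<circ> r')"
      using r h(2) by (simp add: strict_mono_o)
    show "(g(x := h)) l holomorphic_on S" if "l \<in> insert x Q" for l
      using that g h(1) by auto
    show "uniform_limit K (\<lambda>j. F l ((r \<circ> r') j)) ((g(x := h)) l) sequentially"
      if l: "l \<in> insert x Q" and K: "compact K \<and> K \<subseteq> S" for l K
    proof (cases "l = x")
      case True
      then show ?thesis using ul K by simp
    next
      case False
      then have "uniform_limit K (\<lambda>j. F l (r j)) (g l) sequentially"
        using l K g by auto
      from filterlim_compose[OF this filterlim_subseq[OF h(2)]] False show ?thesis
        by (simp add: o_def)
    qed
  qed
qed

text \<open>The Moebius map \<open>(u - f c) / (u + cnj (f c))\<close> takes the right half-plane
  into the unit disc and \<open>f c\<close> to 0. The Schwarz lemma at distance at most half the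
  radius bounds the composition with \<open>f\<close> by 1/2, and the constant is
  \<open>(1 + 1/2) / (1 - 1/2) = 3\<close>.\<close>

lemma Harnack_disc:
  assumes hol: "f holomorphic_on ball c s" and pos: "\<And>z. z \<in> ball c s \<Longrightarrow> 0 < Re (f z)"
    and z: "dist c z \<le> s / 2" and "0 < s"
  shows "Re (f z) \<le> 3 * Re (f c)"
proof -
  define \<phi> :: "complex \<Rightarrow> complex" where
    "\<phi> w = (f (c + complex_of_real s * w) - f c) / (f (c + complex_of_real s * w) + cnj (f c))" for w
  have c: "c \<in> ball c s" and zin: "z \<in> ball c s"
    using z \<open>0 < s\<close> by simp_all
  have inb: "c + s * w \<in> ball c s" if "norm w < 1" for w :: complex
    using that \<open>0 < s\<close> by (simp add: dist_norm norm_mult)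
  have ne: "f (c + s * w) + cnj (f c) \<noteq> 0" if "norm w < 1" for w :: complex
  proof -
    have "Re (f (c + s * w) + cnj (f c)) > 0"
      using pos[OF inb[OF that]] pos[OF c] by simp
    then show ?thesis by (metis less_irrefl zero_complex.sel(1))
  qed
  have img: "(\<lambda>w. c + complex_of_real s * w) ` ball 0 1 \<subseteq> ball c s"
    using inb by auto
  have h1: "(\<lambda>w. f (c + s * w)) holomorphic_on ball 0 1"
  proof -
    have "(\<lambda>w. c + complex_of_real s * w) holomorphic_on ball 0 1"
      by (intro holomorphic_intros)
    then show ?thesis
      using holomorphic_on_compose_gen[OF _ hol img] by (simp add: o_def)
  qed
  have hol\<phi>: "\<phi> holomorphic_on ball 0 1"
    unfolding \<phi>_def using ne by (intro holomorphic_intros h1) auto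
  have lt: "norm (\<phi> w) < 1" if "norm w < 1" for w
  proof -
    let ?a = "f (c + s * w)"
    have "(Re ?a - Re (f c))\<^sup>2 < (Re ?a + Re (f c))\<^sup>2"
      using pos[OF inb[OF that]] pos[OF c] by (simp add: power2_eq_square algebra_simps)
    then have "norm (?a - f c) < norm (?a + cnj (f c))"
      by (simp add: cmod_def)
    then show ?thesis
      using ne[OF that] by (simp add: \<phi>_def norm_divide divide_simps)
  qed
  define w where "w = (z - c) / s"
  have w: "norm w \<le> 1/2"
    using z \<open>0 < s\<close> by (simp add: w_def norm_divide dist_norm norm_minus_commute field_simps)
  have zw: "c + s * w = z"
    using \<open>0 < s\<close> by (simp add: w_def)
  have "norm (\<phi> w) \<le> norm w"
    using w by (intro Schwarz_Lemma(1)[OF hol\<phi> _ lt]) (auto simp: \<phi>_def)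
  then have "norm (f z - f c) / norm (f z + cnj (f c)) \<le> norm w"
    using zw by (simp add: \<phi>_def norm_divide)
  then have "norm (f z - f c) / norm (f z + cnj (f c)) \<le> 1/2"
    using w by linarith
  then have le: "2 * norm (f z - f c) \<le> norm (f z + cnj (f c))"
    using ne[of w] w zw by (simp add: divide_simps)
  let ?x = "Re (f z)" and ?y = "Re (f c)"
  have "(2 * norm (f z - f c))\<^sup>2 \<le> (norm (f z + cnj (f c)))\<^sup>2"
    using le by (intro power_mono) auto
  then have "4 * (?x - ?y)\<^sup>2 \<le> (?x + ?y)\<^sup>2"
    by (simp add: power_mult_distrib cmod_power2 ) (smt (verit) zero_le_power2)
  then have "(2 * \<bar>?x - ?y\<bar>)\<^sup>2 \<le> (?x + ?y)\<^sup>2" by (simp add: power_mult_distrib)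
  moreover have "0 \<le> ?x + ?y"
    using pos[OF c] pos[OF zin] by simp
  ultimately have "2 * \<bar>?x - ?y\<bar> \<le> ?x + ?y"
    by (rule power2_le_imp_le)
  then show ?thesis
    using abs_ge_self[of "?x - ?y"] by argo
qed

section \<open>The limit case without error term\<close>

text \<open>A limit of exponentials may vanish identically, so the limit case speaks of moduli
  instead of harmonic functions \<open>ln (norm (\<psi> l z))\<close>. By \<open>ge1\<close> the
  functions that attain the maximum have no zeros, and only these are divided by.\<close>

lemma top_modulus_le_1:
  fixes \<psi> :: "'i \<Rightarrow> complex \<Rightarrow> complex"
  assumes fin: "finite Q" and card: "2 * N \<le> card Q + 1" and N: "1 \<le> N"
    and S: "open S" "connected S" "c \<in> S"
    and hol: "\<And>l. l \<in> Q \<Longrightarrow> \<psi> l holomorphic_on S"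
    and ge1: "\<And>z. z \<in> S \<Longrightarrow> \<exists>l\<in>Q. 1 \<le> norm (\<psi> l z)"
    and top: "\<And>I z l. \<lbrakk>I \<subseteq> Q; card I = N; z \<in> S; l \<in> Q\<rbrakk> \<Longrightarrow> \<exists>i\<in>I. norm (\<psi> l z) \<le> norm (\<psi> i z)"
    and le1: "\<And>l. l \<in> Q \<Longrightarrow> norm (\<psi> l c) \<le> 1"
    and l: "l \<in> Q" and z: "z \<in> S"
  shows "norm (\<psi> l z) \<le> 1"
proof -
  define P where "P z = {i\<in>Q. \<forall>l\<in>Q. norm (\<psi> l z) \<le> norm (\<psi> i z)}" for z
  have PQ: "P z \<subseteq> Q" "finite (P z)" for z
    using fin by (auto simp: P_def)
  have "Q \<noteq> {}" using l by auto
  \<comment> \<open>With fewer than \<open>N\<close> maximal indices, \<open>card\<close> would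
    leave \<open>N\<close> others, and \<open>top\<close> would make one of these dominate a maximal
    one.\<close>
  have Pcard: "N \<le> card (P z)" if zS: "z \<in> S" for z
  proof (rule ccontr)
    assume "\<not> N \<le> card (P z)"
    then have "N \<le> card (Q - P z)"
      using PQ fin card by (simp add: card_Diff_subset)
    then obtain I where I: "I \<subseteq> Q - P z" "card I = N"
      by (meson obtain_subset_with_card_n)
    have "Max ((\<lambda>l. norm (\<psi> l z)) ` Q) \<in> (\<lambda>l. norm (\<psi> l z)) ` Q"
      using fin \<open>Q \<noteq> {}\<close> by (intro Max_in) auto
    then obtain k where k: "k \<in> Q" "Max ((\<lambda>l. norm (\<psi> l z)) ` Q) = norm (\<psi> k z)"
      by auto
    have kmax: "norm (\<psi> l z) \<le> norm (\<psi> k z)" if "l \<in> Q" for l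
      using that fin k(2) by (metis Max_ge finite_imageI imageI)
    obtain i where "i \<in> I" "norm (\<psi> k z) \<le> norm (\<psi> i z)"
      using top[OF _ I(2) zS k(1)] I(1) by blast
    then have "i \<in> P z"
      using kmax I by (force simp: P_def)
    then show False using I \<open>i \<in> I\<close> by auto
  qed
  \<comment> \<open>At \<open>z0\<close> the set of maximal indices is as small as possible, hence locally constant there.\<close>
  obtain z0 where z0: "z0 \<in> S" "\<And>z. z \<in> S \<Longrightarrow> card (P z0) \<le> card (P z)"
    using S(3) ex_has_least_nat[of "\<lambda>z. z \<in> S" c "\<lambda>z. card (P z)"] by blast
  have "P z0 \<noteq> {}"
    using Pcard[OF z0(1)] N by auto
  then obtain i where i: "i \<in> P z0" by auto
  have iQ: "i \<in> Q" using i PQ by auto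
  have cont: "isCont (\<psi> l) z" if "l \<in> Q" "z \<in> S" for l z
    using hol[OF that(1)] S(1) that(2)
    by (meson continuous_on_interior holomorphic_on_imp_continuous_on interior_open continuous_on_eq_continuous_at)
  have "\<forall>\<^sub>F z in nhds z0. z \<in> S"
    using S(1) z0(1) by (rule eventually_nhds_in_open)
  moreover have "\<forall>\<^sub>F z in nhds z0. \<forall>l\<in>Q - P z0. norm (\<psi> l z) < norm (\<psi> i z)"
  proof (intro eventually_ball_finite ballI)
    fix l assume l: "l \<in> Q - P z0"
    then have "norm (\<psi> l z0) < norm (\<psi> i z0)"
      using i by (force simp: P_def)
    moreover have "((\<lambda>z. norm (\<psi> i z) - norm (\<psi> l z)) \<longlongrightarrow> norm (\<psi> i z0) - norm (\<psi> l z0)) (nhds z0)"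
      using cont[OF iQ z0(1)] cont[of l z0] l z0(1)
      by (intro tendsto_intros) (auto simp: isCont_def tendsto_nhds_iff)
    ultimately have "\<forall>\<^sub>F z in nhds z0. 0 < norm (\<psi> i z) - norm (\<psi> l z)"
      by (intro order_tendstoD(1)) auto
    then show "\<forall>\<^sub>F z in nhds z0. norm (\<psi> l z) < norm (\<psi> i z)"
      by eventually_elim auto
  qed (use fin in auto)
  ultimately have "\<forall>\<^sub>F z in nhds z0. z \<in> S \<and> P z = P z0"
  proof eventually_elim
    case (elim z)
    have "P z \<subseteq> P z0"
    proof
      fix j assume j: "j \<in> P z"
      then have "j \<in> Q" "norm (\<psi> i z) \<le> norm (\<psi> j z)"
        using iQ by (auto simp: P_def)
      then show "j \<in> P z0"
        using elim(2) by (meson DiffI not_le)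
    qed
    then have "P z = P z0"
      using z0(2)[OF elim(1)] PQ(2) by (meson card_seteq)
    then show ?case using elim by auto
  qed
  then obtain e where e: "e > 0" "\<And>z. z \<in> ball z0 e \<Longrightarrow> z \<in> S \<and> P z = P z0"
    by (auto simp: eventually_nhds_metric mem_ball dist_commute)
  have ne: "\<psi> j z \<noteq> 0" if "j \<in> P z0" "z \<in> ball z0 e" for j z
  proof -
    have P: "z \<in> S" "j \<in> P z" using that e(2)[OF that(2)] by auto
    obtain l where "l \<in> Q" "1 \<le> norm (\<psi> l z)"
      using ge1[OF P(1)] by auto
    then have "1 \<le> norm (\<psi> j z)"
      using P(2) by (auto simp: P_def intro: order_trans)
    then show ?thesis by auto
  qed
  \<comment> \<open>Near \<open>z0\<close> the quotient of two maximal functions has modulus 1,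
    hence it is constant. The identity theorem carries the proportionality to all of
    \<open>S\<close>.\<close>
  have same: "norm (\<psi> j z) = norm (\<psi> i z)" if j: "j \<in> P z0" and z: "z \<in> S" for j z
  proof -
    have eq: "norm (\<psi> j z) = norm (\<psi> i z)" if "z \<in> ball z0 e" for z
    proof -
      have "j \<in> P z" "i \<in> P z" using e(2)[OF that] j i by auto
      then show ?thesis using PQ(1) by (intro antisym) (auto simp: P_def)
    qed
    have "(\<lambda>z. \<psi> j z / \<psi> i z) holomorphic_on ball z0 e"
      using ne[OF i] e(2) j PQ(1) iQ
      by (intro holomorphic_on_divide holomorphic_on_subset[OF hol]) blast+
    then have "(\<lambda>z. \<psi> j z / \<psi> i z) constant_on ball z0 e"
    proof (rule maximum_modulus_principle)
      show "norm (\<psi> j z / \<psi> i z) \<le> norm (\<psi> j z0 / \<psi> i z0)" if "z \<in> ball z0 e" for z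
        using eq[OF that] eq[of z0] ne[OF i that] ne[OF i, of z0] e(1) by (simp add: norm_divide)
    qed (use e(1) in auto)
    then obtain d where d: "\<And>z. z \<in> ball z0 e \<Longrightarrow> \<psi> j z / \<psi> i z = d"
      by (auto simp: constant_on_def)
    have "\<psi> j z = d * \<psi> i z"
    proof (rule analytic_continuation_open[where s = "ball z0 e" and s' = S and f = "\<psi> j" and g = "\<lambda>z. d * \<psi> i z"])
      show "\<psi> j z = d * \<psi> i z" if "z \<in> ball z0 e" for z
        using d[OF that] ne[OF i that] by (auto simp: field_simps)
      show "\<psi> j holomorphic_on S" "(\<lambda>z. d * \<psi> i z) holomorphic_on S"
        using j PQ iQ hol by (auto intro!: holomorphic_intros)
      show "ball z0 e \<subseteq> S" using e(2) by blast
    qed (use e(1) z S in auto)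
    moreover have "norm d = 1"
      using d[of z0] eq[of z0] ne[OF i, of z0] e(1) by (auto simp: norm_divide)
    ultimately show ?thesis by (simp add: norm_mult)
  qed
  \<comment> \<open>\<open>top\<close> is applied to \<open>N\<close> indices from
    \<open>P z0\<close>, whose functions share one modulus on all of \<open>S\<close>.\<close>
  have dom: "norm (\<psi> l z) \<le> norm (\<psi> i z)" if "l \<in> Q" "z \<in> S" for l z
  proof -
    obtain I where I: "I \<subseteq> P z0" "card I = N"
      by (meson Pcard z0(1) obtain_subset_with_card_n)
    then show ?thesis
      using top[of I z l] that same PQ by (metis subset_trans subsetD)
  qed
  have ge: "1 \<le> norm (\<psi> i z)" if "z \<in> S" for z
    using ge1[OF that] dom that by (meson order_trans)
  have ci: "norm (\<psi> i c) = 1"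
    using ge[OF S(3)] le1[OF iQ] by simp
  \<comment> \<open>Minimum principle: \<open>\<psi> i\<close> has modulus at least 1 everywhere and
    exactly 1 at \<open>c\<close>.\<close>
  have "(\<lambda>z. inverse (\<psi> i z)) constant_on S"
  proof (rule maximum_modulus_principle[OF _ S(1,2) S(1) order.refl S(3)])
    show "(\<lambda>z. inverse (\<psi> i z)) holomorphic_on S"
      using ge by (intro holomorphic_intros hol[OF iQ]) force
    show "norm (inverse (\<psi> i z)) \<le> norm (inverse (\<psi> i c))" if "z \<in> S" for z
      using ge[OF that] ci by (auto simp: norm_inverse inverse_le_1_iff)
  qed
  then have "inverse (\<psi> i z) = inverse (\<psi> i c)"
    using z S(3) unfolding constant_on_def by metis
  then have "norm (\<psi> i z) = 1" using ci by simp
  then show ?thesis using dom[OF l z] by simp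
qed

section \<open>Logarithms of units with a bounded error\<close>

text \<open>General position in logarithmic form: \<open>Re (g l)\<close> is the logarithm of the
  modulus of the unit \<open>exp (g l)\<close>, and up to \<open>C\<close> the maximum over any
  \<open>N\<close> indices equals the maximum over \<open>Q\<close>. It is used with
  \<open>C = ln K\<close>, where \<open>K\<close> compares the units themselves.\<close>

definition balanced ::
  "'i set \<Rightarrow> nat \<Rightarrow> real \<Rightarrow> complex set \<Rightarrow> ('i \<Rightarrow> complex \<Rightarrow> complex) \<Rightarrow> bool" where
  "balanced Q N C S g \<longleftrightarrow> (\<forall>I\<subseteq>Q. card I = N \<longrightarrow>
     (\<forall>z\<in>S. \<forall>l\<in>Q. \<exists>i\<in>I. Re (g l z) \<le> Re (g i z) + C))"

definition leading :: "'i set \<Rightarrow> ('i \<Rightarrow> complex \<Rightarrow> complex) \<Rightarrow> complex \<Rightarrow> 'i \<Rightarrow> bool" where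
  "leading Q g b k \<longleftrightarrow> k \<in> Q \<and> (\<forall>l\<in>Q. Re (g l b) \<le> Re (g k b))"

lemma leading_exists:
  assumes "finite Q" "Q \<noteq> {}"
  obtains k where "leading Q g b k"
proof -
  have "Max ((\<lambda>l. Re (g l b)) ` Q) \<in> (\<lambda>l. Re (g l b)) ` Q"
    using assms by (intro Max_in) auto
  then obtain k where k: "k \<in> Q" "Max ((\<lambda>l. Re (g l b)) ` Q) = Re (g k b)"
    by auto
  then have "leading Q g b k"
    using assms unfolding leading_def by (metis Max_ge finite_imageI imageI)
  then show thesis by (rule that)
qed

text \<open>
  If this failed for every \<open>T\<close>, the functions \<open>exp ((g l - g k) / T)\<close> would have a limit
  violating \<open>top_modulus_le_1\<close>; the error \<open>C / T\<close> vanishes in the limit.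
\<close>

lemma lead_gap:
  fixes Q :: "'i set"
  assumes fin: "finite Q" and card: "2 * N \<le> card Q + 1" and N: "1 \<le> N" and "0 \<le> A"
  shows "\<exists>T\<ge>1. \<forall>g k. (\<forall>l\<in>Q. g l holomorphic_on ball 0 2) \<and> balanced Q N C (ball 0 2) g \<and>
      leading Q g 0 k \<and> (\<forall>l\<in>Q. \<forall>z\<in>ball 0 2. Re (g l z) \<le> Re (g k z) + A * T) \<longrightarrow>
      (\<forall>l\<in>Q. \<forall>z\<in>cball 0 1. Re (g l z) \<le> Re (g k z) + T)"
proof (rule ccontr)
  assume neg: "\<not> ?thesis"
  \<comment> \<open>Counterexamples are taken at \<open>T = Suc j\<close>, which is at least 1 and
    tends to infinity.\<close>
  have "\<exists>g k. ((\<forall>l\<in>Q. g l holomorphic_on ball 0 2) \<and> balanced Q N C (ball 0 2) g \<and>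
      leading Q g 0 k \<and> (\<forall>l\<in>Q. \<forall>z\<in>ball 0 2. Re (g l z) \<le> Re (g k z) + A * real (Suc j))) \<and>
      \<not> (\<forall>l\<in>Q. \<forall>z\<in>cball 0 1. Re (g l z) \<le> Re (g k z) + real (Suc j))" for j
  proof -
    have "1 \<le> real (Suc j)" by simp
    then show ?thesis using neg by metis
  qed
  then obtain g k where gk: "\<And>j. ((\<forall>l\<in>Q. g j l holomorphic_on ball 0 2) \<and>
      balanced Q N C (ball 0 2) (g j) \<and>
      leading Q (g j) 0 (k j) \<and> (\<forall>l\<in>Q. \<forall>z\<in>ball 0 2. Re (g j l z) \<le> Re (g j (k j) z) + A * real (Suc j))) \<and>
      \<not> (\<forall>l\<in>Q. \<forall>z\<in>cball 0 1. Re (g j l z) \<le> Re (g j (k j) z) + real (Suc j))"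
    by metis
  then have hol: "\<And>j l. l \<in> Q \<Longrightarrow> g j l holomorphic_on ball 0 2"
    and bal: "\<And>j. balanced Q N C (ball 0 2) (g j)"
    and lead: "\<And>j. leading Q (g j) 0 (k j)"
    and bdd: "\<And>j l z. l \<in> Q \<Longrightarrow> z \<in> ball 0 2 \<Longrightarrow> Re (g j l z) \<le> Re (g j (k j) z) + A * real (Suc j)"
    and contra: "\<And>j. \<exists>l\<in>Q. \<exists>z\<in>cball 0 1. Re (g j l z) > Re (g j (k j) z) + real (Suc j)"
    by (simp_all add: not_le)
  have kQ: "k j \<in> Q" for j
    using lead by (simp add: leading_def)
  \<comment> \<open>Dividing by \<open>T = Suc j\<close> turns the assumed bound into the fixed
    bound \<open>exp A\<close> on the moduli, while a failure of the conclusion becomes a modulus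
    above \<open>exp 1\<close>.\<close>
  define F where "F l j z = exp ((g j l z - g j (k j) z) / of_nat (Suc j))" for l j z
  have normF: "norm (F l j z) = exp ((Re (g j l z) - Re (g j (k j) z)) / real (Suc j))" for l j z
    unfolding F_def norm_exp_eq_Re by (simp only: Re_divide_of_nat minus_complex.sel)
  have "\<exists>r \<psi>. strict_mono (r :: nat \<Rightarrow> nat) \<and> (\<forall>l\<in>Q. \<psi> l holomorphic_on ball 0 2 \<and>
     (\<forall>K. compact K \<and> K \<subseteq> ball 0 2 \<longrightarrow> uniform_limit K (\<lambda>j. F l (r j)) (\<psi> l) sequentially))"
  proof (rule Montel_finite[OF fin open_ball])
    show "F l j holomorphic_on ball 0 2" if "l \<in> Q" for l j
      unfolding F_def using that kQ by (intro holomorphic_intros hol) auto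
    show "norm (F l j z) \<le> exp A" if "l \<in> Q" "z \<in> ball 0 2" for l j z
      unfolding normF using bdd[OF that, of j] by (simp add: divide_le_eq algebra_simps)
  qed
  then obtain r \<psi> where r: "strict_mono (r :: nat \<Rightarrow> nat)"
    and hol\<psi>: "\<And>l. l \<in> Q \<Longrightarrow> \<psi> l holomorphic_on ball 0 2"
    and ul: "\<And>l K. l \<in> Q \<Longrightarrow> compact K \<Longrightarrow> K \<subseteq> ball 0 2 \<Longrightarrow>
      uniform_limit K (\<lambda>j. F l (r j)) (\<psi> l) sequentially"
    by blast
  have lim: "(\<lambda>j. norm (F l (r j) z)) \<longlonglongrightarrow> norm (\<psi> l z)" if "l \<in> Q" "z \<in> ball 0 2" for l z
    using tendsto_uniform_limitI[OF ul[of l "{z}"], of z] that by (intro tendsto_norm) auto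
  have F1: "F (k j) j z = 1" for j z
    by (simp add: F_def)
  have le1: "norm (\<psi> l z) \<le> 1" if "l \<in> Q" "z \<in> ball 0 2" for l z
  proof (rule top_modulus_le_1[OF fin card N open_ball _ _ hol\<psi>])
    \<comment> \<open>For each \<open>j\<close> the leading function gives the value 1, but its
      index may vary with \<open>j\<close>. If all limits were below 1, finiteness of
      \<open>Q\<close> would put all functions below 1 for some \<open>j\<close>.\<close>
    show "\<exists>l\<in>Q. 1 \<le> norm (\<psi> l z)" if z: "z \<in> ball 0 2" for z
    proof (rule ccontr)
      assume "\<not> ?thesis"
      then have "\<forall>\<^sub>F j in sequentially. \<forall>l\<in>Q. norm (F l (r j) z) < 1"
        by (intro eventually_ball_finite[OF fin] ballI order_tendstoD(2)[OF lim[OF _ z]])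
           (auto simp: not_le)
      then obtain j where "\<forall>l\<in>Q. norm (F l (r j) z) < 1"
        using eventually_happens'[OF sequentially_bot] by blast
      then have "norm (F (k (r j)) (r j) z) < 1" using kQ by blast
      then show False by (simp add: F1)
    qed
    show "norm (\<psi> l 0) \<le> 1" if "l \<in> Q" for l
    proof (rule tendsto_upperbound[OF lim[OF that]])
      have "norm (F l (r j) 0) \<le> 1" for j
        using lead[of "r j"] that by (simp add: normF leading_def divide_le_0_iff)
      then show "\<forall>\<^sub>F j in sequentially. norm (F l (r j) 0) \<le> 1" by simp
    qed auto
    show "\<exists>i\<in>I. norm (\<psi> l z) \<le> norm (\<psi> i z)"
      if I: "I \<subseteq> Q" "card I = N" and z: "z \<in> ball 0 2" and l: "l \<in> Q" for I l z
    proof (rule ccontr)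
      assume neg: "\<not> ?thesis"
      have e1: "(\<lambda>j. exp (C / real (Suc (r j)))) \<longlonglongrightarrow> exp 0"
        using LIMSEQ_subseq_LIMSEQ[OF LIMSEQ_Suc[OF lim_const_over_n[of C]] r]
        by (intro tendsto_exp) (simp add: o_def)
      have "\<forall>\<^sub>F j in sequentially. \<forall>i\<in>I. 0 < norm (F l (r j) z) - norm (F i (r j) z) * exp (C / real (Suc (r j)))"
      proof (intro eventually_ball_finite ballI)
        show "finite I" using I fin finite_subset by blast
        fix i assume i: "i \<in> I"
        then have "0 < norm (\<psi> l z) - norm (\<psi> i z) * exp 0" using neg by auto
        moreover have "(\<lambda>j. norm (F l (r j) z) - norm (F i (r j) z) * exp (C / real (Suc (r j))))
            \<longlonglongrightarrow> norm (\<psi> l z) - norm (\<psi> i z) * exp 0"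
          using i I l z by (intro tendsto_intros lim e1) auto
        ultimately show "\<forall>\<^sub>F j in sequentially. 0 < norm (F l (r j) z) - norm (F i (r j) z) * exp (C / real (Suc (r j)))"
          by (rule order_tendstoD(1)[rotated])
      qed
      then obtain j where j: "\<forall>i\<in>I. 0 < norm (F l (r j) z) - norm (F i (r j) z) * exp (C / real (Suc (r j)))"
        using eventually_happens'[OF sequentially_bot] by blast
      obtain i where i: "i \<in> I" "Re (g (r j) l z) \<le> Re (g (r j) i z) + C"
        using bal[of "r j"] I z l unfolding balanced_def by blast
      let ?x = "Re (g (r j) l z)" and ?y = "Re (g (r j) i z)" and ?c = "Re (g (r j) (k (r j)) z)"
      have "(?x - ?c) / real (Suc (r j)) \<le> (?y - ?c) / real (Suc (r j)) + C / real (Suc (r j))"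
        unfolding add_divide_distrib[symmetric] using i(2) by (intro divide_right_mono) auto
      then have "norm (F l (r j) z) \<le> norm (F i (r j) z) * exp (C / real (Suc (r j)))"
        unfolding normF exp_add[symmetric] by simp
      then show False using j i(1) by force
    qed
  qed (use that in auto)
  have "\<forall>\<^sub>F j in sequentially. \<forall>l\<in>Q. \<forall>z\<in>cball 0 1. dist (F l (r j) z) (\<psi> l z) < 1"
  proof (intro eventually_ball_finite[OF fin] ballI)
    fix l assume l: "l \<in> Q"
    have "cball (0::complex) 1 \<subseteq> ball 0 2" by auto
    then show "\<forall>\<^sub>F j in sequentially. \<forall>z\<in>cball 0 1. dist (F l (r j) z) (\<psi> l z) < 1"
      using uniform_limitD[OF ul[OF l compact_cball]] by simp
  qed
  then obtain j where j: "\<And>l z. l \<in> Q \<Longrightarrow> z \<in> cball 0 1 \<Longrightarrow> dist (F l (r j) z) (\<psi> l z) < 1"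
    using eventually_happens'[OF sequentially_bot] by blast
  obtain l z where lz: "l \<in> Q" "z \<in> cball 0 1"
      "Re (g (r j) l z) > Re (g (r j) (k (r j)) z) + real (Suc (r j))"
    using contra[of "r j"] by blast
  \<comment> \<open>Closeness within 1 to a limit of modulus at most 1 keeps \<open>F\<close> below
    2, and 2 is at most \<open>exp 1\<close>.\<close>
  have "exp 1 < norm (F l (r j) z)"
    using lz(3) unfolding normF by (simp add: less_divide_eq)
  moreover have "norm (F l (r j) z) < 2"
    using j[OF lz(1,2)] le1[OF lz(1), of z] lz(2) norm_triangle_sub[of "F l (r j) z" "\<psi> l z"]
    by (auto simp: dist_norm)
  moreover have "(2::real) \<le> exp 1"
    using exp_ge_add_one_self[of 1] by simp
  ultimately show False by linarith
qed

section \<open>Propagation of the bound from small to large scales\<close>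

text \<open>The leading index depends on the centre \<open>b\<close>, so bounds at neighbouring
  centres compare with different functions. Linking them costs a Harnack step.\<close>

definition lead_bound :: "'i set \<Rightarrow> ('i \<Rightarrow> complex \<Rightarrow> complex) \<Rightarrow> complex \<Rightarrow> real \<Rightarrow> real \<Rightarrow> bool" where
  "lead_bound Q g b s T \<longleftrightarrow>
     (\<forall>k. leading Q g b k \<longrightarrow> (\<forall>l\<in>Q. \<forall>z\<in>cball b s. Re (g l z) \<le> Re (g k z) + T))"

text \<open>
  The constant comes from eight Harnack steps of length \<open>s / 2\<close>, each of which replaces a bound
  \<open>B * T\<close> by \<open>3 * (B + 2) * T\<close>.
\<close>

lemma lead_bound_chain:
  assumes fin: "finite Q" and s: "0 < s" and T: "0 < T"
    and hol: "\<And>l. l \<in> Q \<Longrightarrow> g l holomorphic_on ball b (5 * s)"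
    and lb: "\<And>c. c \<in> cball b (4 * s) \<Longrightarrow> lead_bound Q g c s T"
  shows "lead_bound Q g b (4 * s) (3 ^ 9 * T)"
  unfolding lead_bound_def
proof (intro allI impI ballI)
  fix k l z
  assume k: "leading Q g b k" and l: "l \<in> Q" and z: "z \<in> cball b (4 * s)"
  have kQ: "k \<in> Q" and ne: "Q \<noteq> {}" using k by (auto simp: leading_def)
  define c where "c i = b + of_real (real i / 8) * (z - b)" for i :: nat
  have nz: "norm (z - b) \<le> 4 * s"
    using z by (simp add: dist_norm norm_minus_commute)
  have cin: "c i \<in> cball b (4 * s)" if "i \<le> 8" for i
  proof -
    have "norm (c i - b) = real i / 8 * norm (z - b)"
      by (simp add: c_def norm_mult)
    also have "\<dots> \<le> 1 * (4 * s)"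
      using that nz by (intro mult_mono) auto
    finally show ?thesis by (simp add: dist_norm norm_minus_commute)
  qed
  \<comment> \<open>The factor \<open>3 ^ (i + 1) - 3\<close> solves the recursion
    \<open>B 0 = 0\<close>, \<open>B (Suc i) = 3 * (B i + 2)\<close>.\<close>
  have main: "\<forall>l\<in>Q. Re (g l (c i)) \<le> Re (g k (c i)) + (3 ^ (i + 1) - 3) * T" if "i \<le> 8" for i
    using that
  proof (induction i)
    case 0
    then show ?case using k by (simp add: leading_def c_def)
  next
    case (Suc i)
    obtain k' where k': "leading Q g (c i) k'"
      using leading_exists[OF fin ne] by blast
    have ci: "c i \<in> cball b (4 * s)" using Suc.prems by (intro cin) auto
    have le: "Re (g l z) \<le> Re (g k' z) + T" if "l \<in> Q" "z \<in> cball (c i) s" for l z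
      using lb[OF ci] k' that by (simp add: lead_bound_def)
    have k'Q: "k' \<in> Q" using k' by (simp add: leading_def)
    \<comment> \<open>As \<open>k'\<close> leads at \<open>c i\<close>, the real part of
      \<open>g k' - g k\<close> is at least \<open>- T\<close> on the disc; the shift by
      \<open>2 * T\<close> makes it positive, as Harnack's inequality requires.\<close>
    define f where "f z = g k' z - g k z + 2 * of_real T" for z
    have sub: "ball (c i) s \<subseteq> ball b (5 * s)"
    proof
      fix w assume "w \<in> ball (c i) s"
      then show "w \<in> ball b (5 * s)"
        using ci dist_triangle[of b w "c i"] by simp
    qed
    have dc: "dist (c i) (c (Suc i)) \<le> s / 2"
    proof -
      have "c (Suc i) - c i = of_real (1 / 8) * (z - b)"
        by (simp add: c_def field_simps)
      then have "norm (c (Suc i) - c i) = 1 / 8 * norm (z - b)"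
        by (simp only: norm_mult norm_of_real)
      then show ?thesis using nz by (simp add: dist_norm norm_minus_commute)
    qed
    have "Re (f (c (Suc i))) \<le> 3 * Re (f (c i))"
    proof (rule Harnack_disc[OF _ _ dc s])
      show "f holomorphic_on ball (c i) s"
        unfolding f_def using sub
        by (intro holomorphic_intros holomorphic_on_subset[OF hol[OF k'Q]] holomorphic_on_subset[OF hol[OF kQ]])
      show "0 < Re (f z)" if "z \<in> ball (c i) s" for z
        using le[OF kQ, of z] that T by (simp add: f_def)
    qed
    moreover have "Re (g k' (c i)) \<le> Re (g k (c i)) + (3 ^ (i + 1) - 3) * T"
      using Suc.IH Suc.prems k'Q by simp
    ultimately have f2: "Re (f (c (Suc i))) \<le> 3 * ((3 ^ (i + 1) - 3) * T + 2 * T)"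
      by (simp add: f_def)
    show ?case
    proof
      fix l assume "l \<in> Q"
      then have "Re (g l (c (Suc i))) \<le> Re (g k' (c (Suc i))) + T"
        using dc s by (intro le) auto
      also have "\<dots> = Re (f (c (Suc i))) + Re (g k (c (Suc i))) - T"
        by (simp add: f_def)
      also have "\<dots> \<le> Re (g k (c (Suc i))) + (3 ^ (Suc i + 1) - 3) * T"
        using f2 T by (simp add: algebra_simps)
      finally show "Re (g l (c (Suc i))) \<le> Re (g k (c (Suc i))) + (3 ^ (Suc i + 1) - 3) * T" .
    qed
  qed
  have "c 8 = z" by (simp add: c_def)
  then have "Re (g l z) \<le> Re (g k z) + (3 ^ 9 - 3) * T"
    using main[of 8] l by simp
  also have "\<dots> \<le> Re (g k z) + 3 ^ 9 * T" using T by simp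
  finally show "Re (g l z) \<le> Re (g k z) + 3 ^ 9 * T" .
qed

text \<open>\<open>T\<close> comes from \<open>lead_gap\<close> with \<open>A = 3 ^ 9\<close> and
  depends only on \<open>Q\<close>, \<open>N\<close> and \<open>C\<close>. The initial scale depends
  on \<open>g\<close>, but each doubling loses the factor \<open>3 ^ 9\<close> in
  \<open>lead_bound_chain\<close> and regains it in \<open>gap\<close>, so the number of doublings
  does not matter.\<close>

proposition lead_bound_universal:
  fixes Q :: "'i set"
  assumes fin: "finite Q" and card: "2 * N \<le> card Q + 1" and N: "1 \<le> N"
  obtains T where "\<And>g. \<lbrakk>\<And>l. l \<in> Q \<Longrightarrow> g l holomorphic_on ball 0 2; balanced Q N C (ball 0 2) g\<rbrakk>
    \<Longrightarrow> lead_bound Q g 0 (1 / 4) T"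
proof -
  obtain T where T: "T \<ge> 1" and gap: "\<And>g k l z. \<lbrakk>\<And>l. l \<in> Q \<Longrightarrow> g l holomorphic_on ball 0 2;
      balanced Q N C (ball 0 2) g; leading Q g 0 k;
      \<And>l z. l \<in> Q \<Longrightarrow> z \<in> ball 0 2 \<Longrightarrow> Re (g l z) \<le> Re (g k z) + 3 ^ 9 * T;
      l \<in> Q; z \<in> cball 0 1\<rbrakk> \<Longrightarrow> Re (g l z) \<le> Re (g k z) + T"
    using lead_gap[OF assms, of "3 ^ 9" C] by (auto 0 4)
  have "lead_bound Q g 0 (1 / 4) T"
    if hol: "\<And>l. l \<in> Q \<Longrightarrow> g l holomorphic_on ball 0 2" and bal: "balanced Q N C (ball 0 2) g" for g
  proof -
    \<comment> \<open>The margin passes from scale \<open>2 * s\<close> at \<open>b\<close> to scale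
      \<open>s\<close> at every centre within \<open>4 * s\<close> of \<open>b\<close>, and at
      \<open>s = 1 / 4\<close> it leaves only \<open>b = 0\<close>.\<close>
    define P where "P s \<longleftrightarrow> (\<forall>b. norm b + 4 * s \<le> 1 \<longrightarrow> lead_bound Q g b s T)" for s
    have dbl: "P (2 * s)" if P: "P s" and s: "0 < s" for s
      unfolding P_def
    proof (intro allI impI)
      fix b :: complex
      assume b: "norm b + 4 * (2 * s) \<le> 1"
      have inb: "w \<in> ball 0 2" if "dist b w < 5 * s" for w
        using norm_triangle_sub[of w b] that b s by (simp add: dist_norm norm_minus_commute)
      have lb: "lead_bound Q g b (4 * s) (3 ^ 9 * T)"
      proof (rule lead_bound_chain[OF fin s])
        show "g l holomorphic_on ball b (5 * s)" if "l \<in> Q" for l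
          using inb by (intro holomorphic_on_subset[OF hol[OF that]]) auto
        show "lead_bound Q g c s T" if "c \<in> cball b (4 * s)" for c
        proof -
          have "norm c + 4 * s \<le> 1"
            using norm_triangle_sub[of c b] that b by (simp add: dist_norm norm_minus_commute)
          then show ?thesis using P by (simp add: P_def)
        qed
      qed (use T in auto)
      show "lead_bound Q g b (2 * s) T"
        unfolding lead_bound_def
      proof (intro allI impI ballI)
        fix k l z
        assume k: "leading Q g b k" and l: "l \<in> Q" and z: "z \<in> cball b (2 * s)"
        \<comment> \<open>Rescaling to the situation of \<open>gap\<close>: the closed unit disc
          becomes \<open>cball b (2 * s)\<close>, and \<open>ball 0 2\<close> lands in
          \<open>cball b (4 * s)\<close>, where the bound \<open>3 ^ 9 * T\<close> is known.\<close>
        define h where "h l w = g l (b + of_real (2 * s) * w)" for l w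
        have db: "dist b (b + of_real (2 * s) * w) = 2 * s * norm w" for w :: complex
          using s by (simp add: dist_norm norm_mult)
        have img: "(\<lambda>w. b + of_real (2 * s) * w) ` ball 0 2 \<subseteq> ball 0 2"
        proof (intro image_subsetI inb)
          fix w :: complex assume "w \<in> ball 0 2"
          then have "2 * s * norm w \<le> 2 * s * 2" using s by (intro mult_left_mono) auto
          then show "dist b (b + of_real (2 * s) * w) < 5 * s"
            unfolding db using s by simp
        qed
        have "Re (h l ((z - b) / of_real (2 * s))) \<le> Re (h k ((z - b) / of_real (2 * s))) + T"
        proof (rule gap[OF _ _ _ _ l])
          show "h l holomorphic_on ball 0 2" if "l \<in> Q" for l
          proof -
            have "(\<lambda>w. b + complex_of_real (2 * s) * w) holomorphic_on ball 0 2"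
              by (intro holomorphic_intros)
            from holomorphic_on_compose_gen[OF this hol[OF that] img]
            have "(g l \<circ> (\<lambda>w. b + complex_of_real (2 * s) * w)) holomorphic_on ball 0 2" .
            moreover have "g l \<circ> (\<lambda>w. b + complex_of_real (2 * s) * w) = h l"
              by (simp add: h_def fun_eq_iff)
            ultimately show ?thesis by simp
          qed
          show "balanced Q N C (ball 0 2) h"
            using bal img unfolding balanced_def h_def by blast
          show "leading Q h 0 k"
            using k by (simp add: leading_def h_def)
          show "Re (h l w) \<le> Re (h k w) + 3 ^ 9 * T" if "l \<in> Q" "w \<in> ball 0 2" for l w
          proof -
            have "2 * s * norm w \<le> 2 * s * 2" using s that by (intro mult_left_mono) auto
            then have "b + of_real (2 * s) * w \<in> cball b (4 * s)"
              unfolding mem_cball db by simp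
            then show ?thesis
              using lb k that(1) unfolding lead_bound_def h_def by blast
          qed
          show "(z - b) / of_real (2 * s) \<in> cball 0 1"
            using z s by (simp add: norm_divide dist_norm norm_minus_commute norm_mult)
        qed
        moreover have "b + of_real (2 * s) * ((z - b) / of_real (2 * s)) = z"
          using s by simp
        ultimately show "Re (g l z) \<le> Re (g k z) + T"
          unfolding h_def by simp
      qed
    qed
    \<comment> \<open>Scales of this form reach \<open>1 / 4\<close> after exactly \<open>j\<close>
      doublings. For large \<open>j\<close> every \<open>g l\<close> varies by less than 1/2 at this
      scale; the variations of \<open>g l\<close> and \<open>g k\<close> together cost at most 1,
      hence at most \<open>T\<close>.\<close>
    have "(\<lambda>j. (1 / 4) / 2 ^ j :: real) \<longlonglongrightarrow> 0"
      by (rule LIMSEQ_divide_realpow_zero) simp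
    have "\<forall>\<^sub>F j in sequentially. \<forall>l\<in>Q. \<forall>b\<in>cball 0 1. \<forall>z\<in>cball 0 1.
        dist z b \<le> (1 / 4) / 2 ^ j \<longrightarrow> dist (g l z) (g l b) < 1 / 2"
    proof (intro eventually_ball_finite[OF fin] ballI)
      fix l assume l: "l \<in> Q"
      have "uniformly_continuous_on (cball 0 1) (g l)"
        using hol[OF l]
        by (intro compact_uniformly_continuous holomorphic_on_imp_continuous_on)
           (auto elim!: holomorphic_on_subset)
      then obtain d where d: "d > 0" "\<And>b z. b \<in> cball 0 1 \<Longrightarrow> z \<in> cball 0 1 \<Longrightarrow> dist z b < d \<Longrightarrow>
          dist (g l z) (g l b) < 1 / 2"
        unfolding uniformly_continuous_on_def by (metis half_gt_zero_iff zero_less_one)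
      have "\<forall>\<^sub>F j in sequentially. (1 / 4) / 2 ^ j < d"
        using \<open>(\<lambda>j. (1 / 4) / 2 ^ j :: real) \<longlonglongrightarrow> 0\<close> d(1) by (rule order_tendstoD(2))
      then show "\<forall>\<^sub>F j in sequentially. \<forall>b\<in>cball 0 1. \<forall>z\<in>cball 0 1.
          dist z b \<le> (1 / 4) / 2 ^ j \<longrightarrow> dist (g l z) (g l b) < 1 / 2"
        by eventually_elim (use d(2) in fastforce)
    qed
    then obtain j where j: "\<And>l b z. \<lbrakk>l \<in> Q; b \<in> cball 0 1; z \<in> cball 0 1;
        dist z b \<le> (1 / 4) / 2 ^ j\<rbrakk> \<Longrightarrow> dist (g l z) (g l b) < 1 / 2"
      using eventually_happens'[OF sequentially_bot] by blast
    have "P ((1 / 4) / 2 ^ j)"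
      unfolding P_def lead_bound_def
    proof (intro allI impI ballI)
      fix b k l z
      assume b: "norm b + 4 * ((1 / 4) / 2 ^ j) \<le> 1" and k: "leading Q g b k"
        and l: "l \<in> Q" and z: "z \<in> cball b ((1 / 4) / 2 ^ j)"
      have "norm (z - b) \<le> (1 / 4) / 2 ^ j" "0 < (1 / 4) / (2::real) ^ j"
        using z by (simp_all add: dist_norm norm_minus_commute)
      then have "norm b \<le> 1" "norm z \<le> 1"
        using b norm_triangle_sub[of z b] by linarith+
      then have bz: "b \<in> cball 0 1" "z \<in> cball 0 1" by simp_all
      have kQ: "k \<in> Q" and le: "Re (g l b) \<le> Re (g k b)" using k l by (auto simp: leading_def)
      have dz: "dist z b \<le> (1 / 4) / 2 ^ j" using z by (simp add: dist_commute)
      have "\<bar>Re (g l z) - Re (g l b)\<bar> < 1 / 2" if "l \<in> Q" for l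
        using j[OF that bz dz] abs_Re_le_cmod[of "g l z - g l b"] by (simp add: dist_norm)
      from this[OF l] this[OF kQ] le show "Re (g l z) \<le> Re (g k z) + T"
        using T by linarith
    qed
    moreover have "P ((1 / 4) / 2 ^ j) \<Longrightarrow> P (1 / 4)"
    proof (induction j)
      case (Suc j)
      from dbl[OF Suc.prems] have "P ((1 / 4) / 2 ^ j)" by simp
      then show ?case by (rule Suc.IH)
    qed simp
    ultimately show ?thesis by (simp add: P_def)
  qed
  then show thesis by (rule that)
qed

section \<open>Holomorphic functions of several variables\<close>

lemma norm_smult_vec: "norm (c *s (v :: complex ^ 'n)) = norm c * norm v"
  by (simp add: norm_vec_def L2_set_right_distrib norm_mult)

lemma bounded_linear_smult_vec: "bounded_linear (\<lambda>t. t *s (v :: complex ^ 'n))"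
proof
  show "\<exists>K. \<forall>t. norm (t *s v) \<le> norm t * K"
    by (metis norm_smult_vec order.refl)
qed (simp_all add: vec_eq_iff algebra_simps)

lemma holo_on_subset: "holo_on h U \<Longrightarrow> V \<subseteq> U \<Longrightarrow> holo_on h V"
  unfolding holo_on_def by blast

lemma holo_on_const: "holo_on (\<lambda>z. c) U"
  unfolding holo_on_def by (auto intro!: exI[of _ "\<lambda>v. 0"])

lemma holo_on_add:
  assumes "holo_on f U" "holo_on g U"
  shows "holo_on (\<lambda>z. f z + g z) U"
  unfolding holo_on_def
proof
  fix z assume "z \<in> U"
  with assms obtain f' g' where "(f has_derivative f') (at z)" "(g has_derivative g') (at z)"
    "\<forall>c v. f' (c *s v) = c * f' v" "\<forall>c v. g' (c *s v) = c * g' v"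
    unfolding holo_on_def by blast
  then show "\<exists>h'. ((\<lambda>z. f z + g z) has_derivative h') (at z) \<and> (\<forall>c v. h' (c *s v) = c * h' v)"
    by (intro exI[of _ "\<lambda>v. f' v + g' v"]) (auto intro!: derivative_eq_intros simp: algebra_simps)
qed

lemma holo_on_mult:
  assumes "holo_on f U" "holo_on g U"
  shows "holo_on (\<lambda>z. f z * g z) U"
  unfolding holo_on_def
proof
  fix z assume "z \<in> U"
  with assms obtain f' g' where "(f has_derivative f') (at z)" "(g has_derivative g') (at z)"
    "\<forall>c v. f' (c *s v) = c * f' v" "\<forall>c v. g' (c *s v) = c * g' v"
    unfolding holo_on_def by blast
  then show "\<exists>h'. ((\<lambda>z. f z * g z) has_derivative h') (at z) \<and> (\<forall>c v. h' (c *s v) = c * h' v)"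
    by (intro exI[of _ "\<lambda>v. f z * g' v + f' v * g z"])
       (auto intro!: derivative_eq_intros simp: algebra_simps)
qed

lemma holo_on_inverse:
  assumes "holo_on f U" "\<And>z. z \<in> U \<Longrightarrow> f z \<noteq> 0"
  shows "holo_on (\<lambda>z. inverse (f z)) U"
  unfolding holo_on_def
proof
  fix z assume z: "z \<in> U"
  with assms(1) obtain f' where "(f has_derivative f') (at z)" "\<forall>c v. f' (c *s v) = c * f' v"
    unfolding holo_on_def by blast
  moreover from this have "((\<lambda>z. inverse (f z)) has_derivative
      (\<lambda>v. - (inverse (f z) * f' v * inverse (f z)))) (at z)"
    using assms(2)[OF z] by (intro Deriv.has_derivative_inverse)
  ultimately show "\<exists>h'. ((\<lambda>z. inverse (f z)) has_derivative h') (at z) \<and> (\<forall>c v. h' (c *s v) = c * h' v)"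
    by (intro exI[of _ "\<lambda>v. - (inverse (f z) * f' v * inverse (f z))"]) (simp add: algebra_simps)
qed

lemma holo_on_diff:
  assumes "holo_on f U" "holo_on g U"
  shows "holo_on (\<lambda>z. f z - g z) U"
  using holo_on_add[OF assms(1) holo_on_mult[OF holo_on_const[of "-1"] assms(2)]] by simp

lemma holo_on_sum:
  assumes "\<And>i. i \<in> I \<Longrightarrow> holo_on (f i) U"
  shows "holo_on (\<lambda>z. \<Sum>i\<in>I. f i z) U"
  using assms
proof (induction I rule: infinite_finite_induct)
  case (insert i I)
  then have "holo_on (\<lambda>z. f i z + (\<Sum>i\<in>I. f i z)) U"
    by (intro holo_on_add) simp_all
  then show ?case using insert.hyps by simp
qed (simp_all add: holo_on_const)

lemma holo_on_cong_open:
  assumes "open U" "\<And>z. z \<in> U \<Longrightarrow> f z = g z" "holo_on f U"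
  shows "holo_on g U"
  unfolding holo_on_def
proof
  fix z assume z: "z \<in> U"
  then obtain h' where "(f has_derivative h') (at z)" and h': "\<forall>c v. h' (c *s v) = c * h' v"
    using assms(3) unfolding holo_on_def by blast
  then have "(g has_derivative h') (at z)"
    by (intro has_derivative_transform_within_open[OF _ assms(1) z assms(2)])
  with h' show "\<exists>h'. (g has_derivative h') (at z) \<and> (\<forall>c v. h' (c *s v) = c * h' v)" by blast
qed

lemma holo_on_local:
  assumes "\<And>z. z \<in> U \<Longrightarrow> \<exists>V. z \<in> V \<and> holo_on f V"
  shows "holo_on f U"
  using assms unfolding holo_on_def by blast

section \<open>Restriction to complex lines and Cauchy estimates\<close>

lemma has_field_derivative_along_line:
  fixes x v :: "complex ^ 'm"
  assumes "(h has_derivative h') (at (x + t *s v))" "\<And>c v. h' (c *s v) = c * h' v"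
  shows "((\<lambda>t. h (x + t *s v)) has_field_derivative h' v) (at t)"
proof -
  have "((\<lambda>t. x + t *s v) has_derivative (\<lambda>t. t *s v)) (at t)"
    by (auto intro!: derivative_eq_intros bounded_linear_imp_has_derivative bounded_linear_smult_vec)
  from diff_chain_at[OF this assms(1)] show ?thesis
    by (simp add: has_field_derivative_def o_def assms(2) mult_commute_abs)
qed

lemma holo_on_along_line:
  fixes x v :: "complex ^ 'm"
  assumes "holo_on h U" "\<And>t. t \<in> S \<Longrightarrow> x + t *s v \<in> U"
  shows "(\<lambda>t. h (x + t *s v)) holomorphic_on S"
  unfolding holomorphic_on_def
proof
  fix t assume "t \<in> S"
  then obtain h' where "(h has_derivative h') (at (x + t *s v))" "\<And>c v. h' (c *s v) = c * h' v"
    using assms unfolding holo_on_def by meson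
  from has_field_derivative_along_line[OF this]
  show "(\<lambda>t. h (x + t *s v)) field_differentiable at t within S"
    using field_differentiable_at_within field_differentiable_def by blast
qed

text \<open>This is the one-variable Cauchy inequality on the line through \<open>x\<close> in
  direction \<open>v\<close>. The radius \<open>e\<close> sends the closed parameter disc onto a
  disc of radius \<open>r / 2\<close>, safely inside the ball; the halving accounts for the factor
  2.\<close>

lemma Cauchy_estimate:
  fixes x v :: "complex ^ 'm"
  assumes hol: "holo_on h (ball x r)" and r: "0 < r"
    and bd: "\<And>z. z \<in> ball x r \<Longrightarrow> norm (h z) \<le> B"
    and h': "(h has_derivative h') (at x)" "\<And>c v. h' (c *s v) = c * h' v"
  shows "norm (h' v) \<le> 2 * B / r * norm v"
proof (cases "v = 0")
  case True
  then show ?thesis using h'(2)[of 0 v] by simp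
next
  case False
  define e where "e = r / (2 * norm v)"
  have e: "0 < e" using r False by (simp add: e_def)
  have inb: "x + t *s v \<in> ball x r" if "t \<in> cball 0 e" for t
  proof -
    have "norm t * norm v \<le> e * norm v" using that by (intro mult_right_mono) auto
    also have "\<dots> < r" using r False by (simp add: e_def)
    finally show ?thesis by (simp add: dist_norm norm_smult_vec)
  qed
  have hl: "(\<lambda>t. h (x + t *s v)) holomorphic_on cball 0 e"
    by (rule holo_on_along_line[OF hol inb])
  have "norm ((deriv ^^ 1) (\<lambda>t. h (x + t *s v)) 0) \<le> fact 1 * B / e ^ 1"
  proof (rule Cauchy_inequality[OF _ _ e])
    show "(\<lambda>t. h (x + t *s v)) holomorphic_on ball 0 e"
      using hl by (rule holomorphic_on_subset) auto
    show "norm (h (x + t *s v)) \<le> B" if "norm (0 - t) = e" for t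
      using inb[of t] that by (intro bd) auto
  qed (use hl holomorphic_on_imp_continuous_on in blast)
  moreover have "deriv (\<lambda>t. h (x + t *s v)) 0 = h' v"
    by (intro DERIV_imp_deriv has_field_derivative_along_line) (use h' in auto)
  ultimately show ?thesis
    by (simp add: e_def algebra_simps)
qed

text \<open>Every point of the half ball has room \<open>r / 2\<close>, so the Cauchy estimate
  bounds the derivative by \<open>2 * B / (r / 2)\<close>; the mean value inequality on the convex
  half ball does the rest. The constant is uniform over a bounded family, which gives
  equicontinuity.\<close>

lemma holo_on_Lipschitz:
  fixes p :: "complex ^ 'm"
  assumes hol: "holo_on h (ball p r)" and r: "0 < r"
    and bd: "\<And>z. z \<in> ball p r \<Longrightarrow> norm (h z) \<le> B"
    and xy: "x \<in> cball p (r / 2)" "y \<in> cball p (r / 2)"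
  shows "norm (h x - h y) \<le> 4 * B / r * norm (x - y)"
proof -
  have sub: "ball z (r / 2) \<subseteq> ball p r" if "z \<in> cball p (r / 2)" for z
  proof
    fix w assume "w \<in> ball z (r / 2)"
    then show "w \<in> ball p r" using that dist_triangle[of p w z] by simp
  qed
  have "p \<in> ball p r" using r by simp
  then have B: "0 \<le> B" using bd norm_ge_zero order_trans by blast
  define h' where "h' z = (SOME h'. (h has_derivative h') (at z) \<and> (\<forall>c v. h' (c *s v) = c * h' v))" for z
  have "\<exists>h'. (h has_derivative h') (at z) \<and> (\<forall>c v. h' (c *s v) = c * h' v)" if "z \<in> cball p (r / 2)" for z
    using hol sub[OF that] r unfolding holo_on_def by (meson centre_in_ball half_gt_zero subsetD)
  from someI_ex[OF this]
  have h': "\<And>z. z \<in> cball p (r / 2) \<Longrightarrow> (h has_derivative h' z) (at z)"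
    "\<And>z c v. z \<in> cball p (r / 2) \<Longrightarrow> h' z (c *s v) = c * h' z v"
    unfolding h'_def by blast+
  show ?thesis
  proof (rule differentiable_bound[OF convex_cball _ _ xy])
    show "(h has_derivative h' z) (at z within cball p (r / 2))" if "z \<in> cball p (r / 2)" for z
      using h'(1)[OF that] by (rule has_derivative_at_withinI)
    show "onorm (h' z) \<le> 4 * B / r" if z: "z \<in> cball p (r / 2)" for z
    proof (rule onorm_bound)
      show "norm (h' z v) \<le> 4 * B / r * norm v" for v
      proof -
        have "norm (h w) \<le> B" if "w \<in> ball z (r / 2)" for w
          using bd sub[OF z] that by blast
        with r have "norm (h' z v) \<le> 2 * B / (r / 2) * norm v"
          by (intro Cauchy_estimate[OF holo_on_subset[OF hol sub[OF z]] _ _ h'[OF z]]) simp_all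
        then show ?thesis by simp
      qed
    qed (use B r in auto)
  qed
qed

section \<open>Uniform limits and Montel's theorem in several variables\<close>

text \<open>Cauchy estimates for the differences \<open>f m - f n\<close> make the derivatives
  uniformly Cauchy near each point. The limit is therefore differentiable, and complex linearity of
  the derivatives passes to the limit.\<close>

lemma holo_on_uniform_limit:
  fixes g :: "complex ^ 'm \<Rightarrow> complex"
  assumes S: "open S" and hol: "\<And>n. holo_on (f n) S"
    and ul: "uniform_limit S f g sequentially"
  shows "holo_on g S"
  unfolding holo_on_def
proof
  fix p assume "p \<in> S"
  then obtain d where "d > 0" "ball p d \<subseteq> S"
    using S open_contains_ball by blast
  \<comment> \<open>Halving the radius leaves every point of \<open>ball p e\<close> a ball of
    radius \<open>e\<close> inside \<open>S\<close>.\<close>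
  then obtain e where e: "e > 0" "ball p (2 * e) \<subseteq> S"
    by (intro that[of "d / 2"]) auto
  have sub: "ball z e \<subseteq> S" if "z \<in> ball p e" for z
  proof
    fix w assume "w \<in> ball z e"
    then show "w \<in> S" using that dist_triangle[of p w z] e(2) by (intro subsetD[OF e(2)]) simp
  qed
  define f' where "f' n z = (SOME f'. (f n has_derivative f') (at z) \<and> (\<forall>c v. f' (c *s v) = c * f' v))" for n z
  have "\<exists>f'. (f n has_derivative f') (at z) \<and> (\<forall>c v. f' (c *s v) = c * f' v)" if "z \<in> S" for n z
    using hol that unfolding holo_on_def by blast
  from someI_ex[OF this]
  have "(f n has_derivative f' n z) (at z) \<and> (\<forall>c v. f' n z (c *s v) = c * f' n z v)" if "z \<in> S" for n z
    using that unfolding f'_def by blast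
  then have f': "\<And>n z. z \<in> S \<Longrightarrow> (f n has_derivative f' n z) (at z)"
    "\<And>n z c v. z \<in> S \<Longrightarrow> f' n z (c *s v) = c * f' n z v"
    by blast+
  have zS: "z \<in> S" if "z \<in> ball p e" for z
    using sub[OF that] e(1) by auto
  have cau: "\<exists>N. \<forall>m\<ge>N. \<forall>n\<ge>N. \<forall>z\<in>ball p e. \<forall>v. norm (f' m z v - f' n z v) \<le> d * norm v"
    if d: "d > 0" for d
  proof -
    have "uniformly_Cauchy_on S f"
      using ul by (intro uniformly_convergent_Cauchy uniformly_convergentI)
    \<comment> \<open>The Cauchy estimate on balls of radius \<open>e\<close> turns the tolerance
      \<open>d * e / 2\<close> into \<open>d\<close>.\<close>
    moreover have "d * e / 2 > 0" using d e(1) by simp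
    ultimately obtain N where N: "\<And>m n z. m \<ge> N \<Longrightarrow> n \<ge> N \<Longrightarrow> z \<in> S \<Longrightarrow> dist (f m z) (f n z) < d * e / 2"
      unfolding uniformly_Cauchy_on_def by meson
    show ?thesis
    proof (intro exI[of _ N] allI impI ballI)
      fix m n z v assume mn: "m \<ge> N" "n \<ge> N" and z: "z \<in> ball p e"
      have "norm ((\<lambda>v. f' m z v - f' n z v) v) \<le> 2 * (d * e / 2) / e * norm v"
      proof (rule Cauchy_estimate)
        show "holo_on (\<lambda>z. f m z - f n z) (ball z e)"
          by (intro holo_on_diff holo_on_subset[OF hol] sub z)
        show "norm (f m w - f n w) \<le> d * e / 2" if "w \<in> ball z e" for w
          using N[OF mn, of w] sub[OF z] that by (auto simp: dist_norm less_imp_le)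
        show "((\<lambda>z. f m z - f n z) has_derivative (\<lambda>v. f' m z v - f' n z v)) (at z)"
          by (intro has_derivative_diff f' zS z)
      qed (use e(1) f'(2)[OF zS[OF z]] in \<open>auto simp: algebra_simps\<close>)
      then show "norm (f' m z v - f' n z v) \<le> d * norm v" using e(1) by simp
    qed
  qed
  define g' where "g' z v = lim (\<lambda>n. f' n z v)" for z v
  have "convergent (\<lambda>n. f' n z v)" if z: "z \<in> ball p e" for z v
  proof (rule Cauchy_convergent, rule metric_CauchyI)
    fix d :: real assume d: "d > 0"
    \<comment> \<open>The added 1 covers \<open>v = 0\<close>.\<close>
    have pos: "0 < norm v + 1" by (simp add: add_nonneg_pos)
    obtain N where N: "\<forall>m\<ge>N. \<forall>n\<ge>N. norm (f' m z v - f' n z v) \<le> d / (norm v + 1) * norm v"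
      using cau[OF divide_pos_pos[OF d pos]] z by blast
    have "d / (norm v + 1) * norm v < d"
      using d pos by (simp add: divide_less_eq algebra_simps)
    then have "\<forall>m\<ge>N. \<forall>n\<ge>N. dist (f' m z v) (f' n z v) < d"
      using N unfolding dist_norm by fastforce
    then show "\<exists>M. \<forall>m\<ge>M. \<forall>n\<ge>M. dist (f' m z v) (f' n z v) < d" by blast
  qed
  then have g': "(\<lambda>n. f' n z v) \<longlonglongrightarrow> g' z v" if "z \<in> ball p e" for z v
    using that unfolding g'_def convergent_LIMSEQ_iff by blast
  have lim: "(\<lambda>n. f n z) \<longlonglongrightarrow> g z" if "z \<in> S" for z
    using tendsto_uniform_limitI[OF ul that] .
  have "\<exists>g0. \<forall>z\<in>ball p e. (\<lambda>n. f n z) \<longlonglongrightarrow> g0 z \<and> (g0 has_derivative g' z) (at z within ball p e)"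
  proof (rule has_derivative_sequence[OF convex_ball])
    show "(f n has_derivative f' n z) (at z within ball p e)" if "z \<in> ball p e" for n z
      using f'(1)[OF zS[OF that]] by (rule has_derivative_at_withinI)
    show "\<forall>\<^sub>F n in sequentially. \<forall>z\<in>ball p e. \<forall>v. norm (f' n z v - g' z v) \<le> d * norm v"
      if d: "d > 0" for d
    proof -
      obtain N where N: "\<And>m n z v. m \<ge> N \<Longrightarrow> n \<ge> N \<Longrightarrow> z \<in> ball p e \<Longrightarrow> norm (f' m z v - f' n z v) \<le> d * norm v"
        using cau[OF d] by blast
      have "norm (f' n z v - g' z v) \<le> d * norm v" if "n \<ge> N" "z \<in> ball p e" for n z v
      proof (rule tendsto_upperbound)
        show "(\<lambda>m. norm (f' n z v - f' m z v)) \<longlonglongrightarrow> norm (f' n z v - g' z v)"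
          by (intro tendsto_intros g' that)
        show "\<forall>\<^sub>F m in sequentially. norm (f' n z v - f' m z v) \<le> d * norm v"
          using eventually_ge_at_top[of N] by (rule eventually_mono) (use N that in blast)
      qed auto
      then show ?thesis unfolding eventually_sequentially by blast
    qed
    show "p \<in> ball p e" using e(1) by simp
    show "(\<lambda>n. f n p) \<longlonglongrightarrow> g p" using \<open>p \<in> S\<close> by (rule lim)
  qed
  then obtain g0 where g0: "\<And>z. z \<in> ball p e \<Longrightarrow> (\<lambda>n. f n z) \<longlonglongrightarrow> g0 z"
     "\<And>z. z \<in> ball p e \<Longrightarrow> (g0 has_derivative g' z) (at z within ball p e)"
    by blast
  have pb: "p \<in> ball p e" using e(1) by simp
  have "(g0 has_derivative g' p) (at p)"
    using g0(2)[OF pb] at_within_open[OF pb open_ball] by simp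
  moreover have "g0 z = g z" if "z \<in> ball p e" for z
    using LIMSEQ_unique[OF g0(1)[OF that] lim[OF zS[OF that]]] .
  ultimately have "(g has_derivative g' p) (at p)"
    by (rule has_derivative_transform_within_open[OF _ open_ball pb])
  moreover have "g' p (c *s v) = c * g' p v" for c v
  proof (rule LIMSEQ_unique[OF g'[OF pb]])
    show "(\<lambda>n. f' n p (c *s v)) \<longlonglongrightarrow> c * g' p v"
      unfolding f'(2)[OF \<open>p \<in> S\<close>] by (intro tendsto_intros g' pb)
  qed
  ultimately show "\<exists>h'. (g has_derivative h') (at p) \<and> (\<forall>c v. h' (c *s v) = c * h' v)" by blast
qed

lemma norm_vec_le_sum: "norm (x :: complex ^ 'n) \<le> (\<Sum>i\<in>UNIV. norm (x $ i))"
  by (simp add: norm_vec_def L2_set_le_sum)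

text \<open>The uniform Lipschitz bound feeds Arzela-Ascoli on the closed half ball. The subsequence
  still depends on the ball; a diagonal argument later removes this dependence.\<close>

proposition holo_map_Montel:
  fixes F :: "nat \<Rightarrow> complex ^ 'm \<Rightarrow> complex ^ 'n"
  assumes hol: "\<And>j. holo_map_on (F j) (ball p r)" and r: "0 < r"
    and bd: "\<And>j z. z \<in> ball p r \<Longrightarrow> norm (F j z) \<le> B"
  shows "\<exists>k G. strict_mono (k :: nat \<Rightarrow> nat) \<and> holo_map_on G (ball p (r / 2)) \<and>
    uniform_limit (cball p (r / 2)) (\<lambda>j. F (k j)) G sequentially"
proof -
  have sub: "cball p (r / 2) \<subseteq> ball p r"
    using r by (simp add: cball_subset_ball_iff)
  have "p \<in> ball p r" using r by simp
  then have B: "0 \<le> B" using bd norm_ge_zero order_trans by blast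
  define L where "L = real CARD('n) * (4 * B / r)"
  have L: "0 \<le> L" using B r by (simp add: L_def)
  have lip: "norm (F j x - F j y) \<le> L * norm (x - y)" if "x \<in> cball p (r / 2)" "y \<in> cball p (r / 2)" for j x y
  proof -
    have "norm (F j x - F j y) \<le> (\<Sum>i\<in>UNIV. norm ((F j x - F j y) $ i))"
      by (rule norm_vec_le_sum)
    also have "\<dots> \<le> (\<Sum>i\<in>(UNIV :: 'n set). 4 * B / r * norm (x - y))"
    proof (rule sum_mono)
      fix i
      show "norm ((F j x - F j y) $ i) \<le> 4 * B / r * norm (x - y)"
        unfolding vector_minus_component
      proof (rule holo_on_Lipschitz[OF _ r _ that])
        show "holo_on (\<lambda>z. F j z $ i) (ball p r)"
          using hol by (simp add: holo_map_on_def)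
        show "norm (F j z $ i) \<le> B" if "z \<in> ball p r" for z
          using bd[OF that, of j] Finite_Cartesian_Product.norm_nth_le[of "F j z" i] by linarith
      qed
    qed
    finally show ?thesis by (simp add: L_def)
  qed
  obtain G k where k: "strict_mono (k :: nat \<Rightarrow> nat)"
    and conv: "\<And>e. 0 < e \<Longrightarrow> \<exists>N. \<forall>n x. n \<ge> N \<and> x \<in> cball p (r / 2) \<longrightarrow> norm (F (k n) x - G x) < e"
  proof (rule Arzela_Ascoli[of "cball p (r / 2)" F B])
    show "\<exists>d>0. \<forall>n y. y \<in> cball p (r / 2) \<and> norm (x - y) < d \<longrightarrow> norm (F n x - F n y) < e"
      if x: "x \<in> cball p (r / 2)" and e: "0 < e" for x e
    proof (intro exI[of _ "e / (L + 1)"] conjI allI impI)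
      \<comment> \<open>The added 1 covers \<open>L = 0\<close>.\<close>
      show "0 < e / (L + 1)" using e L by simp
      fix n y assume y: "y \<in> cball p (r / 2) \<and> norm (x - y) < e / (L + 1)"
      have "norm (F n x - F n y) \<le> L * norm (x - y)" using lip x y by blast
      also have "\<dots> \<le> L * (e / (L + 1))" using y L by (intro mult_left_mono) auto
      also have "\<dots> < e" using e L by (simp add: field_simps)
      finally show "norm (F n x - F n y) < e" .
    qed
  qed (use sub bd in auto)
  have ul: "uniform_limit (cball p (r / 2)) (\<lambda>j. F (k j)) G sequentially"
    using conv unfolding uniform_limit_sequentially_iff dist_norm by blast
  have "holo_map_on G (ball p (r / 2))"
    unfolding holo_map_on_def
  proof
    fix i
    show "holo_on (\<lambda>z. G z $ i) (ball p (r / 2))"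
    proof (rule holo_on_uniform_limit[OF open_ball])
      show "holo_on (\<lambda>z. F (k n) z $ i) (ball p (r / 2))" for n
        using hol[of "k n"] r by (auto simp: holo_map_on_def intro: holo_on_subset)
      show "uniform_limit (ball p (r / 2)) (\<lambda>n z. F (k n) z $ i) (\<lambda>z. G z $ i) sequentially"
        by (intro bounded_linear.uniform_limit[OF bounded_linear_vec_nth] uniform_limit_on_subset[OF ul]) auto
    qed
  qed
  with k ul show ?thesis by blast
qed

section \<open>Maps omitting hyperplanes\<close>

text \<open>The pairing has no conjugation, so it is holomorphic in the point.\<close>

definition lform :: "complex ^ 'n \<Rightarrow> complex ^ 'n \<Rightarrow> complex" where
  "lform a w = (\<Sum>l\<in>UNIV. a $ l * w $ l)"

lemma lform_smult: "lform a (c *s w) = c * lform a w"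
  by (simp add: lform_def sum_distrib_left algebra_simps)

lemma lform_0: "lform a 0 = 0"
  by (simp add: lform_def)

text \<open>Coordinates count as linear forms too, so the estimates that compare forms also bound
  the coordinates.\<close>

lemma lform_axis: "lform (axis l 1) w = w $ l"
  by (simp add: lform_def axis_def if_distrib[of "\<lambda>x. x * _"] cong: if_cong)

lemma norm_lform_le: "norm (lform a w) \<le> (\<Sum>l\<in>UNIV. norm (a $ l)) * norm w"
proof -
  have "norm (lform a w) \<le> (\<Sum>l\<in>UNIV. norm (a $ l * w $ l))"
    unfolding lform_def by (rule norm_sum)
  also have "\<dots> \<le> (\<Sum>l\<in>UNIV. norm (a $ l) * norm w)"
    by (intro sum_mono) (simp add: norm_mult mult_left_mono Finite_Cartesian_Product.norm_nth_le)
  finally show ?thesis by (simp add: sum_distrib_right)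
qed

lemma holo_on_lform: "holo_map_on F U \<Longrightarrow> holo_on (\<lambda>z. lform a (F z)) U"
  unfolding lform_def holo_map_on_def by (intro holo_on_sum holo_on_mult holo_on_const) simp

lemma proj_class_eq_iff:
  assumes "v \<noteq> 0" "w \<noteq> 0"
  shows "proj_class v = proj_class w \<longleftrightarrow> (\<exists>c. c \<noteq> 0 \<and> w = c *s v)"
proof -
  have refl: "proj_rel x x" if "x \<noteq> 0" for x :: "complex ^ 'n"
    using that by (auto simp: proj_rel_def intro!: exI[of _ 1])
  have "proj_class v = proj_class w \<longleftrightarrow> proj_rel v w"
    unfolding proj_class_def using Quotient_rel[OF Quotient_proj, of v w] refl[OF assms(1)] refl[OF assms(2)] by blast
  then show ?thesis using assms by (simp add: proj_rel_def)
qed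

lemma proj_class_in_hyperplane_iff:
  assumes "w \<noteq> 0"
  shows "proj_class w \<in> hyperplane a \<longleftrightarrow> lform a w = 0"
proof
  assume "proj_class w \<in> hyperplane a"
  then obtain v where v: "v \<noteq> 0" "proj_class v = proj_class w" "lform a v = 0"
    by (auto simp: hyperplane_def lform_def)
  then obtain c where "w = c *s v"
    using proj_class_eq_iff[OF v(1) assms] by auto
  then show "lform a w = 0" using v(3) by (simp add: lform_smult)
next
  assume "lform a w = 0"
  then show "proj_class w \<in> hyperplane a"
    using assms unfolding hyperplane_def lform_def by blast
qed

section \<open>Zero divisors and normalized representations\<close>

text \<open>The infimum of the empty set is infinite, so the order 0 is attained by some term, and
  the term of degree 0 is the value at \<open>a\<close>.\<close>

lemma vanishing_order_eq_0:
  assumes "vanishing_order h a = 0"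
  shows "h a \<noteq> 0"
proof -
  let ?S = "{enat k | k. \<exists>w. homogeneous_term h a k w \<noteq> 0}"
  have "?S \<noteq> {}"
    using assms unfolding vanishing_order_def Inf_enat_def by (auto split: if_splits)
  then have "Inf ?S \<in> ?S"
    using wellorder_InfI[of _ ?S] by blast
  then have "0 \<in> ?S"
    using assms unfolding vanishing_order_def by simp
  then obtain w where "homogeneous_term h a 0 w \<noteq> 0"
    by (auto simp: zero_enat_def)
  then show ?thesis by (simp add: homogeneous_term_def)
qed

text \<open>The value selected in \<open>divisor\<close> belongs to some representation
  \<open>F\<close> and some coefficient vector \<open>b\<close> of the same hyperplane. A nonzero
  form at \<open>z\<close> forces \<open>F z \<noteq> 0\<close>, so \<open>z\<close> is not a point
  of indeterminacy, and membership in the hyperplane translates \<open>b\<close> back to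
  \<open>a\<close>.\<close>

lemma divisor_eq_0_imp_nonzero:
  assumes f: "meromorphic_map D f" and z: "z \<in> D" and a: "a \<noteq> 0"
    and div: "divisor D f (hyperplane a) z = 0"
  obtains w where "f z = Some (proj_class w)" "lform a w \<noteq> 0"
proof -
  let ?P = "\<lambda>\<nu>. \<exists>U F b. z \<in> U \<and> admissible_rep D f U F \<and> b \<noteq> 0 \<and>
     hyperplane a = hyperplane b \<and> \<nu> = vanishing_order (\<lambda>y. \<Sum>l\<in>UNIV. b $ l * F y $ l) z"
  obtain U F where "z \<in> U" "admissible_rep D f U F"
    using f z unfolding meromorphic_map_def by blast
  then have "\<exists>\<nu>. ?P \<nu>" using a by blast
  then have "?P (SOME \<nu>. ?P \<nu>)" by (rule someI_ex)
  then have "?P 0" using div unfolding divisor_def by simp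
  then obtain U F b where zU: "z \<in> U" and adm: "admissible_rep D f U F" and b: "hyperplane a = hyperplane b"
    and van: "vanishing_order (\<lambda>y. \<Sum>l\<in>UNIV. b $ l * F y $ l) z = 0"
    by metis
  have nz: "lform b (F z) \<noteq> 0"
    using vanishing_order_eq_0[OF van] by (simp add: lform_def)
  then have "F z \<noteq> 0" by (auto simp: lform_0)
  then have "z \<notin> indeterminacy D f"
    using adm zU by (auto simp: admissible_rep_def vec_eq_iff)
  then have "f z = Some (proj_class (F z))"
    using adm zU by (auto simp: admissible_rep_def)
  moreover have "lform a (F z) \<noteq> 0"
    using proj_class_in_hyperplane_iff[OF \<open>F z \<noteq> 0\<close>] nz b by metis
  ultimately show thesis by (rule that)
qed

text \<open>Requiring the form to be 1 removes the freedom of scaling. Any local representation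
  divided by its form therefore equals \<open>\<Phi>\<close>, so these quotients glue to one
  holomorphic representation on all of \<open>D\<close>.\<close>

lemma normalized_rep:
  assumes f: "meromorphic_map D f" and D: "open D"
    and av: "\<And>z. z \<in> D \<Longrightarrow> \<exists>w. f z = Some (proj_class w) \<and> lform a w \<noteq> 0"
  obtains \<Phi> where "admissible_rep D f D \<Phi>"
    "\<And>z. z \<in> D \<Longrightarrow> f z = Some (proj_class (\<Phi> z)) \<and> lform a (\<Phi> z) = 1"
proof -
  define \<Phi> where "\<Phi> z = (SOME w. f z = Some (proj_class w) \<and> lform a w = 1)" for z
  have "\<exists>w. f z = Some (proj_class w) \<and> lform a w = 1" if zD: "z \<in> D" for z
  proof -
    obtain w where w: "f z = Some (proj_class w)" "lform a w \<noteq> 0"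
      using av[OF zD] by blast
    then have "w \<noteq> 0" "inverse (lform a w) *s w \<noteq> 0"
      by (auto simp: lform_0)
    then have "proj_class w = proj_class (inverse (lform a w) *s w)"
      using proj_class_eq_iff w(2) by (metis inverse_nonzero_iff_nonzero)
    then show ?thesis
      using w by (intro exI[of _ "inverse (lform a w) *s w"]) (simp add: lform_smult)
  qed
  from someI_ex[OF this]
  have \<Phi>: "f z = Some (proj_class (\<Phi> z))" "lform a (\<Phi> z) = 1" if "z \<in> D" for z
    using that unfolding \<Phi>_def by blast+
  have nz: "\<Phi> z \<noteq> 0" if "z \<in> D" for z
    using \<Phi>(2)[OF that] by (auto simp: lform_0)
  have ind: "indeterminacy D f = {}"
    using \<Phi>(1) by (auto simp: indeterminacy_def)
  have "holo_on (\<lambda>z. \<Phi> z $ i) D" for i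
  proof (rule holo_on_local)
    fix z assume "z \<in> D"
    then obtain U F where zU: "z \<in> U" and adm: "admissible_rep D f U F"
      using f unfolding meromorphic_map_def by blast
    have U: "open U" "U \<subseteq> D" "holo_map_on F U"
      using adm by (auto simp: admissible_rep_def)
    have FN: "F y \<noteq> 0" "f y = Some (proj_class (F y))" if "y \<in> U" for y
      using adm ind that by (auto simp: admissible_rep_def vec_eq_iff)
    have eq: "lform a (F y) \<noteq> 0 \<and> F y $ i * inverse (lform a (F y)) = \<Phi> y $ i" if y: "y \<in> U" for y
    proof -
      have yD: "y \<in> D" using y U by blast
      have "proj_class (\<Phi> y) = proj_class (F y)"
        using FN(2)[OF y] \<Phi>(1)[OF yD] by simp
      then obtain c where c: "c \<noteq> 0" "F y = c *s \<Phi> y"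
        using proj_class_eq_iff[OF nz[OF yD] FN(1)[OF y]] by blast
      then show ?thesis using \<Phi>(2)[OF yD] by (simp add: lform_smult)
    qed
    have Fi: "holo_on (\<lambda>y. F y $ i) U"
      using U(3) by (simp add: holo_map_on_def)
    have "holo_on (\<lambda>y. inverse (lform a (F y))) U"
      by (rule holo_on_inverse[OF holo_on_lform[OF U(3)]]) (use eq in blast)
    from holo_on_mult[OF Fi this] have "holo_on (\<lambda>z. \<Phi> z $ i) U"
      by (rule holo_on_cong_open[OF U(1), rotated]) (use eq in blast)
    then show "\<exists>V. z \<in> V \<and> holo_on (\<lambda>z. \<Phi> z $ i) V" using zU by blast
  qed
  moreover have "{z \<in> D. \<forall>l. \<Phi> z $ l = 0} = {}"
    using nz by (auto simp: vec_eq_iff)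
  ultimately have "admissible_rep D f D \<Phi>"
    using D ind \<Phi>(1) by (simp add: admissible_rep_def holo_map_on_def)
  then show thesis using \<Phi> by (rule that[OF _ conjI])
qed

section \<open>General position as domination between linear forms\<close>

text \<open>Independent forms are linear coordinates: the inverse matrix recovers \<open>w\<close>
  from their values, so every coordinate, and with it every form, is bounded by the largest of them.
  The index depends on \<open>w\<close>, the constant does not.\<close>

lemma dominated_by_independent:
  fixes a :: "'n \<Rightarrow> complex ^ 'n"
  assumes "det (\<chi> i. a i) \<noteq> 0"
  obtains K where "0 \<le> K" "\<And>w. \<exists>i. norm (lform b w) \<le> K * norm (lform (a i) w)"
proof -
  define A where "A = (\<chi> i. a i)"
  have "invertible A" using assms by (simp add: A_def invertible_det_nz)
  then obtain B where B: "B ** A = mat 1" unfolding invertible_def by blast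
  define K where "K = (\<Sum>l\<in>UNIV. norm (b $ l) * (\<Sum>j\<in>UNIV. norm (B $ l $ j)))"
  have K: "0 \<le> K" unfolding K_def by (intro sum_nonneg mult_nonneg_nonneg) auto
  have "\<exists>i. norm (lform b w) \<le> K * norm (lform (a i) w)" for w
  proof -
    have "Max (range (\<lambda>i. norm (lform (a i) w))) \<in> range (\<lambda>i. norm (lform (a i) w))"
      by (intro Max_in) auto
    then obtain i where i: "Max (range (\<lambda>i. norm (lform (a i) w))) = norm (lform (a i) w)" by blast
    have le: "norm (lform (a j) w) \<le> norm (lform (a i) w)" for j
      unfolding i[symmetric] by (intro Max_ge) auto
    have Aw: "(A *v w) $ j = lform (a j) w" for j
      by (simp add: A_def matrix_vector_mult_def lform_def)
    have w: "w $ l = (\<Sum>j\<in>UNIV. B $ l $ j * lform (a j) w)" for l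
    proof -
      have "w $ l = (B *v (A *v w)) $ l" by (simp add: matrix_vector_mul_assoc B)
      also have "\<dots> = (\<Sum>j\<in>UNIV. B $ l $ j * (A *v w) $ j)"
        by (simp add: matrix_vector_mult_def[of B])
      finally show ?thesis by (simp only: Aw)
    qed
    have "norm (w $ l) \<le> (\<Sum>j\<in>UNIV. norm (B $ l $ j)) * norm (lform (a i) w)" for l
    proof -
      have "norm (w $ l) \<le> (\<Sum>j\<in>UNIV. norm (B $ l $ j * lform (a j) w))"
        unfolding w by (rule norm_sum)
      also have "\<dots> \<le> (\<Sum>j\<in>UNIV. norm (B $ l $ j) * norm (lform (a i) w))"
        by (intro sum_mono) (simp add: norm_mult mult_left_mono le)
      finally show ?thesis by (simp add: sum_distrib_right)
    qed
    then have "norm (b $ l * w $ l) \<le> norm (b $ l) * (\<Sum>j\<in>UNIV. norm (B $ l $ j)) * norm (lform (a i) w)" for l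
      unfolding norm_mult mult.assoc by (intro mult_left_mono) auto
    then have "(\<Sum>l\<in>UNIV. norm (b $ l * w $ l)) \<le> K * norm (lform (a i) w)"
      unfolding K_def sum_distrib_right by (intro sum_mono)
    then have "norm (lform b w) \<le> K * norm (lform (a i) w)"
      unfolding lform_def[of b] by (rule order_trans[OF norm_sum])
    then show ?thesis by blast
  qed
  with K show thesis by (rule that)
qed

text \<open>Adding up the constants of the finitely many pairs \<open>(I, b)\<close> yields a common
  one; the extra 1 keeps it positive even if all of them are 0, so that its logarithm makes
  sense.\<close>

lemma general_position_domination:
  fixes a :: "nat \<Rightarrow> complex ^ 'n"
  assumes gp: "\<forall>\<sigma> :: 'n \<Rightarrow> nat. inj \<sigma> \<and> range \<sigma> \<subseteq> {1..q} \<longrightarrow> det (\<chi> i. a (\<sigma> i)) \<noteq> 0"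
    and fin: "finite X"
  obtains K where "1 \<le> K" "\<And>I b w. \<lbrakk>I \<subseteq> {1..q}; card I = CARD('n); b \<in> X\<rbrakk> \<Longrightarrow>
    \<exists>i\<in>I. norm (lform b w) \<le> K * norm (lform (a i) w)"
proof -
  define \<I> where "\<I> = {I. I \<subseteq> {1..q} \<and> card I = CARD('n)}"
  have fI: "finite \<I>" unfolding \<I>_def by simp
  have "\<exists>K\<ge>0. \<forall>w. \<exists>i\<in>I. norm (lform b w) \<le> K * norm (lform (a i) w)" if I: "I \<in> \<I>" for I b
  proof -
    have "finite I" "card I = card (UNIV :: 'n set)"
      using I finite_subset by (auto simp: \<I>_def)
    \<comment> \<open>The determinant condition is phrased by injections of the coordinate type, so
      \<open>I\<close> is enumerated by that type.\<close>
    then obtain \<sigma> :: "'n \<Rightarrow> nat" where \<sigma>: "bij_betw \<sigma> UNIV I"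
      by (metis finite_same_card_bij finite_code)
    then have "det (\<chi> i. a (\<sigma> i)) \<noteq> 0"
      using gp I by (auto simp: bij_betw_def \<I>_def)
    then obtain K where "0 \<le> K" "\<And>w. \<exists>i. norm (lform b w) \<le> K * norm (lform (a (\<sigma> i)) w)"
      using dominated_by_independent[of "\<lambda>i. a (\<sigma> i)" b] by auto
    then show ?thesis using \<sigma> by (metis bij_betwE UNIV_I)
  qed
  then obtain K where K: "\<And>I b. I \<in> \<I> \<Longrightarrow> 0 \<le> K I b"
      "\<And>I b w. I \<in> \<I> \<Longrightarrow> \<exists>i\<in>I. norm (lform b w) \<le> K I b * norm (lform (a i) w)"
    by metis
  define M where "M = 1 + (\<Sum>(I, b)\<in>\<I> \<times> X. K I b)"
  have M1: "1 \<le> M" unfolding M_def using K(1) by (auto intro!: sum_nonneg)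
  have KM: "K I b \<le> M" if "I \<in> \<I>" "b \<in> X" for I b
  proof -
    have "(\<lambda>(I, b). K I b) (I, b) \<le> (\<Sum>(I, b)\<in>\<I> \<times> X. K I b)"
      using that K(1) fI fin by (intro member_le_sum) auto
    then show ?thesis by (simp add: M_def)
  qed
  show thesis
  proof (rule that[OF M1])
    fix I b w assume I: "I \<subseteq> {1..q}" "card I = CARD('n)" and b: "b \<in> X"
    then have II: "I \<in> \<I>" by (simp add: \<I>_def)
    obtain i where i: "i \<in> I" and "norm (lform b w) \<le> K I b * norm (lform (a i) w)"
      using K(2)[OF II] by blast
    note this(2)
    also have "\<dots> \<le> M * norm (lform (a i) w)"
      using KM[OF II b] by (intro mult_right_mono) auto
    finally show "\<exists>i\<in>I. norm (lform b w) \<le> M * norm (lform (a i) w)" using i by blast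
  qed
qed

text \<open>On a complex line through \<open>p\<close> the zero-free functions have holomorphic
  logarithms \<open>g l\<close>, and the factor \<open>K\<close> becomes the additive error
  \<open>ln K\<close>. Since the bound of \<open>lead_bound_universal\<close> is uniform,
  \<open>exp T\<close> serves for all lines, balls and families.\<close>

proposition units_bound:
  fixes Q :: "'i set"
  assumes fin: "finite Q" and card: "2 * N \<le> card Q + 1" and N: "1 \<le> N" and K: "1 \<le> K"
  obtains M where "\<And>(F :: 'i \<Rightarrow> complex ^ 'm \<Rightarrow> complex) p R k l z.
    \<lbrakk>0 < R; \<And>l. l \<in> Q \<Longrightarrow> holo_on (F l) (ball p R); \<And>l z. l \<in> Q \<Longrightarrow> z \<in> ball p R \<Longrightarrow> F l z \<noteq> 0;
     \<And>I z l. \<lbrakk>I \<subseteq> Q; card I = N; z \<in> ball p R; l \<in> Q\<rbrakk> \<Longrightarrow> \<exists>i\<in>I. norm (F l z) \<le> K * norm (F i z);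
     k \<in> Q; \<And>l. l \<in> Q \<Longrightarrow> norm (F l p) \<le> norm (F k p); l \<in> Q; z \<in> ball p (R / 8)\<rbrakk>
    \<Longrightarrow> norm (F l z) \<le> M * norm (F k z)"
proof -
  obtain T where T: "\<And>g. \<lbrakk>\<And>l. l \<in> Q \<Longrightarrow> g l holomorphic_on ball 0 2; balanced Q N (ln K) (ball 0 2) g\<rbrakk>
    \<Longrightarrow> lead_bound Q g 0 (1 / 4) T"
    using lead_bound_universal[OF fin card N, of "ln K"] by blast
  show thesis
  proof (rule that[of "exp T"])
    fix F :: "'i \<Rightarrow> complex ^ 'm \<Rightarrow> complex" and p R k l z
    assume R: "0 < R" and hol: "\<And>l. l \<in> Q \<Longrightarrow> holo_on (F l) (ball p R)"
      and nz: "\<And>l z. l \<in> Q \<Longrightarrow> z \<in> ball p R \<Longrightarrow> F l z \<noteq> 0"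
      and dom: "\<And>I z l. \<lbrakk>I \<subseteq> Q; card I = N; z \<in> ball p R; l \<in> Q\<rbrakk> \<Longrightarrow> \<exists>i\<in>I. norm (F l z) \<le> K * norm (F i z)"
      and k: "k \<in> Q" and lead: "\<And>l. l \<in> Q \<Longrightarrow> norm (F l p) \<le> norm (F k p)"
      and l: "l \<in> Q" and z: "z \<in> ball p (R / 8)"
    \<comment> \<open>The point \<open>z\<close> gets the parameter \<open>1 / 4\<close>, the radius
      in \<open>lead_bound_universal\<close>, while \<open>norm (z - p) < R / 8\<close> keeps the
      whole disc \<open>ball 0 2\<close> of parameters inside \<open>ball p R\<close>.\<close>
    define v where "v = 4 *s (z - p)"
    have "norm v = 4 * norm (z - p)"
      unfolding v_def norm_smult_vec by simp
    then have v: "norm v \<le> R / 2"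
      using z by (simp add: dist_norm norm_minus_commute)
    have inb: "p + t *s v \<in> ball p R" if "t \<in> ball 0 2" for t
    proof -
      have "norm t * norm v \<le> norm t * (R / 2)" using v by (intro mult_left_mono) auto
      also have "\<dots> < 2 * (R / 2)" using that R by (intro mult_strict_right_mono) auto
      finally show ?thesis by (simp add: dist_norm norm_smult_vec)
    qed
    have "\<exists>h. h holomorphic_on ball 0 2 \<and> (\<forall>t\<in>ball 0 2. exp (h t) = F l (p + t *s v))" if lQ: "l \<in> Q" for l
    proof (rule holomorphic_logarithm_exists[OF convex_ball open_ball])
      show "(\<lambda>t. F l (p + t *s v)) holomorphic_on ball 0 2"
        by (rule holo_on_along_line[OF hol[OF lQ] inb])
      show "F l (p + t *s v) \<noteq> 0" if "t \<in> ball 0 2" for t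
        using nz[OF lQ inb[OF that]] .
      show "(0 :: complex) \<in> ball 0 2" by simp
    qed blast
    then obtain g where g: "\<And>l. l \<in> Q \<Longrightarrow> g l holomorphic_on ball 0 2"
      and exp_g: "\<And>l t. l \<in> Q \<Longrightarrow> t \<in> ball 0 2 \<Longrightarrow> exp (g l t) = F l (p + t *s v)"
      by metis
    have norm_F: "norm (F l (p + t *s v)) = exp (Re (g l t))" if "l \<in> Q" "t \<in> ball 0 2" for l t
      using exp_g[OF that] by (metis norm_exp_eq_Re)
    have "lead_bound Q g 0 (1 / 4) T"
    proof (rule T[OF g])
      show "balanced Q N (ln K) (ball 0 2) g"
        unfolding balanced_def
      proof (intro allI impI ballI)
        fix I t l assume I: "I \<subseteq> Q" "card I = N" and t: "t \<in> ball (0 :: complex) 2" and l: "l \<in> Q"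
        obtain i where i: "i \<in> I" "norm (F l (p + t *s v)) \<le> K * norm (F i (p + t *s v))"
          using dom[OF I inb[OF t] l] by blast
        have "i \<in> Q" using i(1) I(1) by blast
        have "exp (Re (g l t)) \<le> exp (Re (g i t) + ln K)"
          using i(2) K unfolding norm_F[OF l t] norm_F[OF \<open>i \<in> Q\<close> t] by (simp add: exp_add mult.commute)
        then show "\<exists>i\<in>I. Re (g l t) \<le> Re (g i t) + ln K" using i(1) by auto
      qed
    qed
    moreover have "leading Q g 0 k"
    proof -
      have "Re (g l 0) \<le> Re (g k 0)" if "l \<in> Q" for l
        using lead[OF that] norm_F[OF that, of 0] norm_F[OF k, of 0] by simp
      then show ?thesis using k by (simp add: leading_def)
    qed
    moreover have "(1 / 4 :: complex) \<in> cball 0 (1 / 4)" by (simp add: norm_divide)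
    ultimately have "Re (g l (1 / 4)) \<le> Re (g k (1 / 4)) + T"
      using l unfolding lead_bound_def by blast
    moreover have b: "(1 / 4 :: complex) \<in> ball 0 2" by (simp add: norm_divide)
    ultimately have "norm (F l (p + (1 / 4) *s v)) \<le> exp T * norm (F k (p + (1 / 4) *s v))"
      unfolding norm_F[OF l b] norm_F[OF k b] exp_add[symmetric] by simp
    moreover have "p + (1 / 4) *s v = z" by (simp add: v_def vec_eq_iff)
    ultimately show "norm (F l z) \<le> exp T * norm (F k z)" by simp
  qed
qed

section \<open>Meromorphic convergence from bounded representations\<close>

lemma admissible_rep_subset:
  assumes "admissible_rep D f U F" "open V" "V \<subseteq> U"
  shows "admissible_rep D f V F"
  using assms unfolding admissible_rep_def holo_map_on_def
  by (auto intro: holo_on_subset)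

text \<open>The scalars between \<open>X j\<close> and \<open>Y j\<close> vary with
  \<open>j\<close>. Proportionality is therefore written as polynomial equations between the
  coordinates, which pass to the limit; a nonzero coordinate of \<open>x\<close> recovers the
  scalar.\<close>

lemma proj_class_limit_unique:
  fixes x y :: "complex ^ 'n"
  assumes X: "X \<longlonglongrightarrow> x" "x \<noteq> 0" and Y: "Y \<longlonglongrightarrow> y" "y \<noteq> 0"
    and XY: "\<And>j. X j \<noteq> 0" "\<And>j. Y j \<noteq> 0" "\<And>j. proj_class (X j) = proj_class (Y j)"
  shows "proj_class x = proj_class y"
proof -
  have cross: "Y j $ m * X j $ l = X j $ m * Y j $ l" for j l m
  proof -
    obtain c where "Y j = c *s X j"
      using proj_class_eq_iff[OF XY(1) XY(2)] XY(3) by blast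
    then show ?thesis by simp
  qed
  have lim: "y $ m * x $ l = x $ m * y $ l" for l m
  proof (rule LIMSEQ_unique)
    show "(\<lambda>j. Y j $ m * X j $ l) \<longlonglongrightarrow> y $ m * x $ l"
      by (intro tendsto_intros X Y)
    show "(\<lambda>j. Y j $ m * X j $ l) \<longlonglongrightarrow> x $ m * y $ l"
      unfolding cross by (intro tendsto_intros X Y)
  qed
  obtain l where l: "x $ l \<noteq> 0"
    using X(2) by (auto simp: vec_eq_iff)
  have y: "y = (y $ l / x $ l) *s x"
    using lim l by (simp add: vec_eq_iff field_simps)
  then have "y $ l / x $ l \<noteq> 0"
    using Y(2) by (metis vector_smult_lzero)
  with y show ?thesis
    using proj_class_eq_iff[OF X(2) Y(2)] by blast
qed

text \<open>The upper bounds give Montel's theorem on each ball, and a diagonal subsequence over a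
  countable cover converges on all of them. The lower bounds survive in the limit, so the local
  limits have no common zeros; they define the same projective point on overlaps and glue to an
  everywhere defined map.\<close>

proposition meromorphically_normal_if_bounded_reps:
  fixes D :: "(complex ^ 'm::finite) set" and \<F> :: "('m, 'n::finite) pmap set"
  assumes ne: "D \<noteq> {}"
    and reps: "\<And>p. p \<in> D \<Longrightarrow> \<exists>r>0. \<exists>\<delta>>0. \<exists>B. ball p r \<subseteq> D \<and> (\<forall>f\<in>\<F>. \<exists>\<Phi>. admissible_rep D f D \<Phi> \<and>
      (\<forall>z\<in>ball p r. \<delta> \<le> norm (\<Phi> z) \<and> norm (\<Phi> z) \<le> B))"
  shows "meromorphically_normal D \<F>"
  unfolding meromorphically_normal_def
proof (intro allI impI)
  fix s :: "nat \<Rightarrow> ('m, 'n) pmap"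
  assume s: "range s \<subseteq> \<F>"
  have "\<exists>r \<delta> B. 0 < r \<and> 0 < \<delta> \<and> ball p r \<subseteq> D \<and> (\<forall>f\<in>\<F>. \<exists>\<Phi>. admissible_rep D f D \<Phi> \<and>
      (\<forall>z\<in>ball p r. \<delta> \<le> norm (\<Phi> z) \<and> norm (\<Phi> z) \<le> B))" if "p \<in> D" for p
    using reps[OF that] by blast
  then obtain r \<delta> B where r: "\<And>p. p \<in> D \<Longrightarrow> 0 < r p" and \<delta>: "\<And>p. p \<in> D \<Longrightarrow> (0::real) < \<delta> p"
    and sub: "\<And>p. p \<in> D \<Longrightarrow> ball p (r p) \<subseteq> D"
    and ex: "\<And>p f. p \<in> D \<Longrightarrow> f \<in> \<F> \<Longrightarrow> \<exists>\<Phi>. admissible_rep D f D \<Phi> \<and>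
      (\<forall>z\<in>ball p (r p). \<delta> p \<le> norm (\<Phi> z) \<and> norm (\<Phi> z) \<le> B p)"
    by metis
  define \<Phi> where "\<Phi> p j = (SOME \<Phi>. admissible_rep D (s j) D \<Phi> \<and>
      (\<forall>z\<in>ball p (r p). \<delta> p \<le> norm (\<Phi> z) \<and> norm (\<Phi> z) \<le> B p))" for p j
  have "admissible_rep D (s j) D (\<Phi> p j) \<and>
      (\<forall>z\<in>ball p (r p). \<delta> p \<le> norm (\<Phi> p j z) \<and> norm (\<Phi> p j z) \<le> B p)" if "p \<in> D" for p j
  proof -
    have "s j \<in> \<F>" using s by blast
    from someI_ex[OF ex[OF that this]] show ?thesis unfolding \<Phi>_def .
  qed
  then have adm: "\<And>p j. p \<in> D \<Longrightarrow> admissible_rep D (s j) D (\<Phi> p j)"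
    and low: "\<And>p j z. p \<in> D \<Longrightarrow> z \<in> ball p (r p) \<Longrightarrow> \<delta> p \<le> norm (\<Phi> p j z)"
    and upp: "\<And>p j z. p \<in> D \<Longrightarrow> z \<in> ball p (r p) \<Longrightarrow> norm (\<Phi> p j z) \<le> B p"
    by blast+
  \<comment> \<open>The half balls still cover \<open>D\<close>, and \<open>holo_map_Montel\<close>
    gives uniform convergence on their closures.\<close>
  define U where "U p = ball p (r p / 2)" for p
  obtain \<C> where \<C>: "\<C> \<subseteq> U ` D" "countable \<C>" "\<Union>\<C> = \<Union>(U ` D)"
    by (rule Lindelof[of "U ` D"]) (auto simp: U_def)
  then obtain P where P: "P \<subseteq> D" "countable P" "\<C> = U ` P"
    using countable_subset_image[of \<C> U D] by auto
  have pU: "p \<in> U p" if "p \<in> D" for p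
    using r[OF that] by (simp add: U_def)
  have cover: "\<exists>p\<in>P. z \<in> U p" if "z \<in> D" for z
    using pU[OF that] that \<C>(3) P(3) by blast
  have "P \<noteq> {}" using cover ne by blast
  \<comment> \<open>\<open>from_nat_into\<close> makes a sequence of the cover even if
    \<open>P\<close> is finite; points are then repeated.\<close>
  define c where "c = from_nat_into P"
  have cD: "c i \<in> D" for i
    using from_nat_into[OF \<open>P \<noteq> {}\<close>] P(1) by (auto simp: c_def)
  have rangec: "range c = P"
    unfolding c_def by (rule range_from_nat_into) (use P \<open>P \<noteq> {}\<close> in auto)
  have cover': "\<exists>i. z \<in> U (c i)" if "z \<in> D" for z
    using cover[OF that] rangec by blast
  define conv where "conv i k G \<longleftrightarrow> holo_map_on G (U (c i)) \<and>
      uniform_limit (cball (c i) (r (c i) / 2)) (\<lambda>j. \<Phi> (c i) (k j)) G sequentially"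
    for i and k :: "nat \<Rightarrow> nat" and G
  obtain k where k: "strict_mono (k :: nat \<Rightarrow> nat)" and conv_k: "\<And>i. \<exists>G. conv i (id \<circ> k) G"
  proof (rule subsequence_diagonalization_lemma[of "\<lambda>i k. \<exists>G. conv i k G" id])
    fix i and k :: "nat \<Rightarrow> nat"
    have "\<exists>k' G. strict_mono (k' :: nat \<Rightarrow> nat) \<and> holo_map_on G (ball (c i) (r (c i) / 2)) \<and>
        uniform_limit (cball (c i) (r (c i) / 2)) (\<lambda>j. \<Phi> (c i) (k (k' j))) G sequentially"
    proof (rule holo_map_Montel)
      show "holo_map_on (\<Phi> (c i) (k j)) (ball (c i) (r (c i)))" for j
        using adm[OF cD] sub[OF cD] unfolding admissible_rep_def holo_map_on_def
        by (blast intro: holo_on_subset)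
    qed (use r[OF cD] upp[OF cD] in auto)
    then show "\<exists>k'. strict_mono (k' :: nat \<Rightarrow> nat) \<and> (\<exists>G. conv i (k \<circ> k') G)"
      unfolding conv_def U_def o_def by blast
  next
    \<comment> \<open>Second condition of the diagonal lemma: convergence depends only on the tail.
      From \<open>N\<close> on, \<open>k2 j\<close> is a value of \<open>k1\<close> at an index at
      least \<open>j\<close>, so the same threshold works.\<close>
    fix i N and k k1 k2 :: "nat \<Rightarrow> nat"
    assume "\<exists>G. conv i (k \<circ> k1) G" and k12: "\<And>j. N \<le> j \<Longrightarrow> \<exists>j'. j \<le> j' \<and> k2 j = k1 j'"
    then obtain G where G: "conv i (k \<circ> k1) G" by blast
    have "uniform_limit (cball (c i) (r (c i) / 2)) (\<lambda>j. \<Phi> (c i) ((k \<circ> k2) j)) G sequentially"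
      unfolding uniform_limit_sequentially_iff
    proof (intro allI impI)
      fix e :: real assume "e > 0"
      then obtain M where M: "\<And>j z. j \<ge> M \<Longrightarrow> z \<in> cball (c i) (r (c i) / 2) \<Longrightarrow>
          dist (\<Phi> (c i) ((k \<circ> k1) j) z) (G z) < e"
        using G unfolding conv_def uniform_limit_sequentially_iff by blast
      have "dist (\<Phi> (c i) ((k \<circ> k2) j) z) (G z) < e"
        if jz: "j \<ge> max M N" "z \<in> cball (c i) (r (c i) / 2)" for j z
      proof -
        obtain j' where "j \<le> j'" "k2 j = k1 j'" using k12[of j] jz(1) by auto
        then show ?thesis using M[of j' z] jz by simp
      qed
      then show "\<exists>M. \<forall>j\<ge>M. \<forall>z\<in>cball (c i) (r (c i) / 2). dist (\<Phi> (c i) ((k \<circ> k2) j) z) (G z) < e"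
        by blast
    qed
    then show "\<exists>G. conv i (k \<circ> k2) G" using G unfolding conv_def by blast
  qed (rule that, assumption, blast)
  define G where "G i = (SOME G. conv i k G)" for i
  have G: "conv i k (G i)" for i
  proof -
    have "\<exists>G. conv i k G" using conv_k[of i] by simp
    then show ?thesis unfolding G_def by (rule someI_ex)
  qed
  have Gul: "uniform_limit (cball (c i) (r (c i) / 2)) (\<lambda>j. \<Phi> (c i) (k j)) (G i) sequentially" for i
    using G by (simp add: conv_def)
  have UB: "U (c i) \<subseteq> ball (c i) (r (c i))" "U (c i) \<subseteq> cball (c i) (r (c i) / 2)" for i
    using r[OF cD[of i]] by (auto simp: U_def)
  have UD: "U (c i) \<subseteq> D" for i
    using UB(1) sub[OF cD] by blast
  have Glim: "(\<lambda>j. \<Phi> (c i) (k j) z) \<longlonglongrightarrow> G i z" if "z \<in> U (c i)" for i z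
    by (rule tendsto_uniform_limitI[OF Gul subsetD[OF UB(2) that]])
  have \<Phi>nz: "\<Phi> (c i) j z \<noteq> 0" if "z \<in> U (c i)" for i j z
    using low[OF cD subsetD[OF UB(1) that], of j] \<delta>[OF cD[of i]] by auto
  have Gnz: "G i z \<noteq> 0" if "z \<in> U (c i)" for i z
  proof -
    have "\<delta> (c i) \<le> norm (G i z)"
      by (rule tendsto_lowerbound[OF tendsto_norm[OF Glim[OF that]]])
         (use low[OF cD subsetD[OF UB(1) that]] in simp_all)
    then show ?thesis using \<delta>[OF cD[of i]] by auto
  qed
  have \<Phi>f: "s j z = Some (proj_class (\<Phi> (c i) j z))" if "z \<in> U (c i)" for i j z
  proof -
    have zD: "z \<in> D" using UD that by blast
    have "\<not> (\<forall>l. \<Phi> (c i) j z $ l = 0)"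
      using \<Phi>nz[OF that, of j] by (simp add: vec_eq_iff)
    then have "z \<notin> indeterminacy D (s j)"
      using adm[OF cD[of i], of j] zD unfolding admissible_rep_def by blast
    then show ?thesis
      using adm[OF cD[of i], of j] zD unfolding admissible_rep_def by blast
  qed
  \<comment> \<open>The choice of the ball is immaterial by \<open>fG\<close>. Where no ball
    contains \<open>z\<close>, the value is arbitrary, but such \<open>z\<close> lie outside
    \<open>D\<close>.\<close>
  define f :: "('m, 'n) pmap" where
    "f z = Some (proj_class (G (SOME i. z \<in> U (c i)) z))" for z
  have fG: "f z = Some (proj_class (G i z))" if z: "z \<in> U (c i)" for i z
  proof -
    define i' where "i' = (SOME i. z \<in> U (c i))"
    have z': "z \<in> U (c i')"
      unfolding i'_def using z by (rule someI)
    have "proj_class (G i' z) = proj_class (G i z)"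
    proof (rule proj_class_limit_unique[OF Glim[OF z'] Gnz[OF z'] Glim[OF z] Gnz[OF z]])
      show "proj_class (\<Phi> (c i') (k j) z) = proj_class (\<Phi> (c i) (k j) z)" for j
        using \<Phi>f[OF z, of "k j"] \<Phi>f[OF z', of "k j"] by simp
    qed (use \<Phi>nz z z' in blast)+
    then show ?thesis by (simp add: f_def i'_def)
  qed
  have ind: "indeterminacy D f = {}"
    by (auto simp: indeterminacy_def f_def)
  have admG: "admissible_rep D f (U (c i)) (G i)" for i
  proof -
    have "{z \<in> U (c i). \<forall>l. G i z $ l = 0} = {}"
      using Gnz[of _ i] by (auto simp: vec_eq_iff)
    then show ?thesis
      using G[of i] UD[of i] fG[of _ i] ind unfolding admissible_rep_def conv_def
      by (simp add: U_def)
  qed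
  have "meromorphic_map D f"
    unfolding meromorphic_map_def ind
  proof (intro conjI ballI)
    show "analytic_subset D {}"
      unfolding analytic_subset_def
    proof (intro conjI ballI)
      fix a assume "a \<in> D"
      then obtain i where i: "a \<in> U (c i)" using cover' by blast
      \<comment> \<open>The empty set is cut out locally by the constant function 1.\<close>
      show "\<exists>V H. open V \<and> a \<in> V \<and> V \<subseteq> D \<and> finite H \<and> (\<forall>g\<in>H. holo_on g V) \<and>
          {} \<inter> V = {z \<in> V. \<forall>g\<in>H. g z = 0}"
        by (rule exI[of _ "U (c i)"], rule exI[of _ "{\<lambda>z. 1}"])
           (use i UD in \<open>auto simp: U_def holo_on_const\<close>)
    qed simp
    show "codim_ge {} 2"
      by (simp add: codim_ge_def regular_point_def)
    show "\<exists>V F. a \<in> V \<and> admissible_rep D f V F" if "a \<in> D" for a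
      using cover'[OF that] admG by blast
  qed
  moreover have "\<exists>V F H. open V \<and> connected V \<and> a \<in> V \<and> V \<subseteq> D \<and>
        (\<forall>j. admissible_rep D ((s \<circ> k) j) V (F j)) \<and> holo_map_on H V \<and>
        (\<forall>l K. compact K \<and> K \<subseteq> V \<longrightarrow>
           uniform_limit K (\<lambda>j z. F j z $ l) (\<lambda>z. H z $ l) sequentially) \<and>
        (\<exists>l\<^sub>0. \<exists>z\<in>V. H z $ l\<^sub>0 \<noteq> 0) \<and>
        (\<forall>z \<in> V - {z. \<forall>l. H z $ l = 0}. f z = Some (proj_class (H z)))" if a: "a \<in> D" for a
  proof -
    obtain i where i: "a \<in> U (c i)" using cover'[OF a] by blast
    show ?thesis
    proof (rule exI[of _ "U (c i)"], rule exI[of _ "\<lambda>j. \<Phi> (c i) (k j)"], rule exI[of _ "G i"],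
        intro conjI allI impI)
      show "open (U (c i))" "connected (U (c i))" by (simp_all add: U_def)
      show "a \<in> U (c i)" "U (c i) \<subseteq> D" by fact+
      show "admissible_rep D ((s \<circ> k) j) (U (c i)) (\<Phi> (c i) (k j))" for j
        using admissible_rep_subset[OF adm[OF cD[of i], of "k j"] _ UD[of i]] by (simp add: U_def)
      show "holo_map_on (G i) (U (c i))" using G by (simp add: conv_def)
      show "uniform_limit K (\<lambda>j z. \<Phi> (c i) (k j) z $ l) (\<lambda>z. G i z $ l) sequentially"
        if "compact K \<and> K \<subseteq> U (c i)" for l K
      proof (rule bounded_linear.uniform_limit[OF bounded_linear_vec_nth])
        show "uniform_limit K (\<lambda>j. \<Phi> (c i) (k j)) (G i) sequentially"
          by (rule uniform_limit_on_subset[OF Gul[of i]]) (use that UB(2)[of i] in blast)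
      qed
      show "\<exists>l\<^sub>0. \<exists>z\<in>U (c i). G i z $ l\<^sub>0 \<noteq> 0"
        using Gnz[OF i] i by (auto simp: vec_eq_iff)
      show "\<forall>z\<in>U (c i) - {z. \<forall>l. G i z $ l = 0}. f z = Some (proj_class (G i z))"
        using fG by blast
    qed
  qed
  ultimately have "converges_meromorphically D (s \<circ> k) f"
    unfolding converges_meromorphically_def by blast
  with k show "\<exists>k f. strict_mono k \<and> converges_meromorphically D (s \<circ> k) f" by blast
qed

section \<open>Bounded representations of maps that omit 2n + 1 hyperplanes\<close>

theorem corollary1p6:
  fixes n :: nat
    and D :: "(complex ^ 'm::finite) set"
    and \<F> :: "('m::finite, 'n::finite) pmap set"
    and H :: "nat \<Rightarrow> 'n::finite proj set"
  assumes "n \<ge> 1" and "CARD('n) = n + 1"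
    and "open D" and "connected D" and "D \<noteq> {}"
    and "\<forall>f\<in>\<F>. meromorphic_map D f"
    and "general_position (2 * n + 1) H"
    and "\<forall>k\<in>{1..2 * n + 1}. \<forall>f\<in>\<F>.
           \<not> image_contained D f (H k) \<and> (\<forall>z\<in>D. divisor D f (H k) z = 0)"
  shows "meromorphically_normal D \<F>"
proof (rule meromorphically_normal_if_bounded_reps[OF \<open>D \<noteq> {}\<close>])
  fix p assume pD: "p \<in> D"
  define Q where "Q = {1..2 * n + 1}"
  have Q: "finite Q" "Q \<noteq> {}" "card Q = 2 * n + 1" by (simp_all add: Q_def)
  obtain a :: "nat \<Rightarrow> complex ^ 'n" where a: "\<And>k. k \<in> Q \<Longrightarrow> a k \<noteq> 0" "\<And>k. k \<in> Q \<Longrightarrow> H k = hyperplane (a k)"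
    and det: "\<forall>\<sigma> :: 'n \<Rightarrow> nat. inj \<sigma> \<and> range \<sigma> \<subseteq> {1..2 * n + 1} \<longrightarrow> det (\<chi> i. a (\<sigma> i)) \<noteq> 0"
    using assms(7) unfolding general_position_def Q_def by blast
  \<comment> \<open>The coordinate forms \<open>axis l 1\<close> are included, so the same
    \<open>K\<close> compares the given forms with each other and the coordinates with the given
    forms.\<close>
  obtain K where K: "1 \<le> K" and dom: "\<And>I b w. \<lbrakk>I \<subseteq> Q; card I = CARD('n); b \<in> a ` Q \<union> range (\<lambda>l. axis l 1)\<rbrakk> \<Longrightarrow>
    \<exists>i\<in>I. norm (lform b w) \<le> K * norm (lform (a i) w)"
    using general_position_domination[OF det, of "a ` Q \<union> range (\<lambda>l. axis l 1)"] Q(1)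
    unfolding Q_def by auto
  \<comment> \<open>The number of hyperplanes enters here, with equality:
    \<open>2 * (n + 1) = (2 * n + 1) + 1\<close>.\<close>
  have card: "2 * CARD('n) \<le> card Q + 1" "1 \<le> CARD('n)"
    using assms(2) Q(3) by simp_all
  obtain M where M: "\<And>(F :: nat \<Rightarrow> complex ^ 'm \<Rightarrow> complex) p R k l z.
    \<lbrakk>0 < R; \<And>l. l \<in> Q \<Longrightarrow> holo_on (F l) (ball p R); \<And>l z. l \<in> Q \<Longrightarrow> z \<in> ball p R \<Longrightarrow> F l z \<noteq> 0;
     \<And>I z l. \<lbrakk>I \<subseteq> Q; card I = CARD('n); z \<in> ball p R; l \<in> Q\<rbrakk> \<Longrightarrow> \<exists>i\<in>I. norm (F l z) \<le> K * norm (F i z);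
     k \<in> Q; \<And>l. l \<in> Q \<Longrightarrow> norm (F l p) \<le> norm (F k p); l \<in> Q; z \<in> ball p (R / 8)\<rbrakk>
    \<Longrightarrow> norm (F l z) \<le> M * norm (F k z)"
    using units_bound[OF Q(1) card K, where 'm = 'm] by blast
  obtain R where R: "R > 0" "ball p R \<subseteq> D"
    using assms(3) pD open_contains_ball by blast
  obtain I where I: "I \<subseteq> Q" "card I = CARD('n)"
    using obtain_subset_with_card_n[of "CARD('n)" Q] Q(3) assms(2) by auto
  \<comment> \<open>The leading index will depend on the map, so the lower bound needs a majorant
    for all \<open>k\<close> at once; the added 1 makes \<open>S\<close> positive.\<close>
  define S where "S = 1 + (\<Sum>k\<in>Q. \<Sum>l\<in>UNIV. norm (a k $ l))"
  have S: "(\<Sum>l\<in>UNIV. norm (a k $ l)) \<le> S" if "k \<in> Q" for k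
    using member_le_sum[OF that, of "\<lambda>k. \<Sum>l\<in>UNIV. norm (a k $ l)"] Q(1)
    by (simp add: S_def sum_nonneg)
  have S0: "0 < S" unfolding S_def by (intro add_pos_nonneg sum_nonneg) auto
  have "\<exists>\<Phi>. admissible_rep D f D \<Phi> \<and> (\<forall>z\<in>ball p (R / 8). 1 / S \<le> norm (\<Phi> z) \<and>
      norm (\<Phi> z) \<le> real CARD('n) * (K * M))" if f: "f \<in> \<F>" for f
  proof -
    have mer: "meromorphic_map D f" using assms(6) f by blast
    have av: "\<exists>w. f z = Some (proj_class w) \<and> lform (a k) w \<noteq> 0" if "k \<in> Q" "z \<in> D" for k z
    proof -
      have "divisor D f (hyperplane (a k)) z = 0"
        using assms(8) that f unfolding a(2)[OF that(1), symmetric] Q_def by blast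
      then show ?thesis
        using divisor_eq_0_imp_nonzero[OF mer that(2) a(1)[OF that(1)]] by metis
    qed
    have nz: "lform (a k) w \<noteq> 0" if kz: "k \<in> Q" "z \<in> D" and w: "w \<noteq> 0" "f z = Some (proj_class w)" for k z w
    proof -
      obtain w' where w': "f z = Some (proj_class w')" "lform (a k) w' \<noteq> 0"
        using av[OF kz] by blast
      then have "w' \<noteq> 0" by (auto simp: lform_0)
      then show ?thesis
        using proj_class_in_hyperplane_iff[of w "a k"] proj_class_in_hyperplane_iff[of w' "a k"] w w' by auto
    qed
    obtain k0 where "k0 \<in> Q" using Q(2) by blast
    obtain w where w: "f p = Some (proj_class w)" "w \<noteq> 0"
      using av[OF \<open>k0 \<in> Q\<close> pD] lform_0 by metis
    \<comment> \<open>The index \<open>k\<close> is chosen with arbitrary coordinates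
      \<open>w\<close> of \<open>f p\<close>, because \<open>\<Phi>\<close> is normalized by the
      form of index \<open>k\<close>. Rescaling does not change which form is largest.\<close>
    have "Max ((\<lambda>l. norm (lform (a l) w)) ` Q) \<in> (\<lambda>l. norm (lform (a l) w)) ` Q"
      using Q by (intro Max_in) auto
    then obtain k where k: "k \<in> Q" "Max ((\<lambda>l. norm (lform (a l) w)) ` Q) = norm (lform (a k) w)" by blast
    have kmax: "norm (lform (a l) w) \<le> norm (lform (a k) w)" if "l \<in> Q" for l
      unfolding k(2)[symmetric] using that Q(1) by (intro Max_ge) auto
    obtain \<Phi> where adm: "admissible_rep D f D \<Phi>"
      and \<Phi>: "\<And>z. z \<in> D \<Longrightarrow> f z = Some (proj_class (\<Phi> z)) \<and> lform (a k) (\<Phi> z) = 1"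
      using normalized_rep[OF mer assms(3) av[OF k(1)]] by blast
    have \<Phi>nz: "\<Phi> z \<noteq> 0" if "z \<in> D" for z
      using \<Phi>[OF that] by (auto simp: lform_0)
    have bound: "norm (lform (a l) (\<Phi> z)) \<le> M * norm (lform (a k) (\<Phi> z))"
      if l: "l \<in> Q" and z: "z \<in> ball p (R / 8)" for l z
    proof (rule M[OF R(1) _ _ _ k(1) _ l z])
      show "holo_on (\<lambda>z. lform (a l) (\<Phi> z)) (ball p R)" for l
        using adm R(2) holo_on_subset[OF holo_on_lform] unfolding admissible_rep_def by blast
      show "lform (a l) (\<Phi> z) \<noteq> 0" if "l \<in> Q" "z \<in> ball p R" for l z
        using nz[OF that(1), of z "\<Phi> z"] \<Phi> \<Phi>nz R(2) that(2) by blast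
      show "\<exists>i\<in>I. norm (lform (a l) (\<Phi> z)) \<le> K * norm (lform (a i) (\<Phi> z))"
        if "I \<subseteq> Q" "card I = CARD('n)" "l \<in> Q" for I z l
        using that by (intro dom) auto
      show "norm (lform (a l) (\<Phi> p)) \<le> norm (lform (a k) (\<Phi> p))" if "l \<in> Q" for l
      proof -
        have "proj_class w = proj_class (\<Phi> p)" using \<Phi>[OF pD] w(1) by simp
        then obtain c where "\<Phi> p = c *s w"
          using proj_class_eq_iff[OF w(2) \<Phi>nz[OF pD]] by blast
        then show ?thesis
          using kmax[OF that] by (simp add: lform_smult norm_mult mult_left_mono)
      qed
    qed
    have "1 / S \<le> norm (\<Phi> z) \<and> norm (\<Phi> z) \<le> real CARD('n) * (K * M)"
      if z: "z \<in> ball p (R / 8)" for z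
    proof
      have "z \<in> ball p R" using z R(1) by simp
      then have zD: "z \<in> D" using R(2) by blast
      have one: "lform (a k) (\<Phi> z) = 1" using \<Phi>[OF zD] by blast
      \<comment> \<open>A form with value 1 keeps \<open>\<Phi>\<close> away from 0.\<close>
      have "1 \<le> (\<Sum>l\<in>UNIV. norm (a k $ l)) * norm (\<Phi> z)"
        using norm_lform_le[of "a k" "\<Phi> z"] one by simp
      also have "\<dots> \<le> S * norm (\<Phi> z)"
        using S[OF k(1)] by (intro mult_right_mono) auto
      finally show "1 / S \<le> norm (\<Phi> z)" using S0 by (simp add: divide_le_eq mult.commute)
      \<comment> \<open>Each coordinate is dominated by one of the forms with index in
        \<open>I\<close>, and these are at most \<open>M\<close> because the form of index
        \<open>k\<close> is 1.\<close>
      have "norm (\<Phi> z $ l) \<le> K * M" for l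
      proof -
        obtain i where i: "i \<in> I" "norm (lform (axis l 1) (\<Phi> z)) \<le> K * norm (lform (a i) (\<Phi> z))"
          using dom[OF I, of "axis l 1" "\<Phi> z"] by blast
        have "norm (lform (a i) (\<Phi> z)) \<le> M"
          using bound[of i z] i(1) I(1) z one by auto
        then have "K * norm (lform (a i) (\<Phi> z)) \<le> K * M"
          using K by (intro mult_left_mono) auto
        then show ?thesis using i(2) unfolding lform_axis by linarith
      qed
      then have "(\<Sum>l\<in>UNIV. norm (\<Phi> z $ l)) \<le> (\<Sum>l\<in>(UNIV :: 'n set). K * M)"
        by (intro sum_mono)
      then show "norm (\<Phi> z) \<le> real CARD('n) * (K * M)"
        using norm_vec_le_sum[of "\<Phi> z"] by simp
    qed
    with adm show ?thesis by blast
  qed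
  moreover have "ball p (R / 8) \<subseteq> D"
    using R by (auto intro!: subsetD[OF R(2)])
  ultimately show "\<exists>r>0. \<exists>\<delta>>0. \<exists>B. ball p r \<subseteq> D \<and> (\<forall>f\<in>\<F>. \<exists>\<Phi>. admissible_rep D f D \<Phi> \<and>
      (\<forall>z\<in>ball p r. \<delta> \<le> norm (\<Phi> z) \<and> norm (\<Phi> z) \<le> B))"
    using R(1) S0
    by (intro exI[of _ "R / 8"] exI[of _ "1 / S"] exI[of _ "real CARD('n) * (K * M)"] conjI) auto
qed

end
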